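(* Let $A\in\mathbb{R}^{m\times n}$ have rank $r$ and condition number $$\kappa(A):=\frac{\sigma_1(A)}{\sigma_r(A)}\le\kappa_0$$ for some fixed $\kappa_0\ge 1$. Fix $\varepsilon\in(0,1/4)$ and $\delta\in(0,1/10)$. Let $\Phi\in\mathbb{R}^{s\times m}$ be a sparse oblivious subspace embedding (for example, an OSNAP or CountSketch transform) with $$s\ \ge\ C\,\varepsilon^{-2}\,r\log(r/\delta)$$ for a sufficiently large absolute constant $C>0$. Form $B:=\Phi A\in\mathbb{R}^{s\times n}$ and compute its thin singular value decomposition $$B=\widetilde U\,\widetilde\Sigma\,\widetilde V^{\top},\qquad \widetilde\Sigma=\mathrm{diag}(\widetilde\sigma_1,\dots,\widetilde\sigma_r),\qquad \widetilde\sigma_1\ge\dots\ge\widetilde\sigma_r>0.$$ Define the geometric mean and the balancing weights $$\widetilde g:=\Bigl(\prod_{i=1}^r\widetilde\sigma_i\Bigr)^{1/r},\qquad \lambda_i:=\frac{\widetilde g}{\widetilde\sigma_i},\quad i=1,\dots,r.$$ Set $$\Lambda:=\mathrm{diag}(\lambda_1,\dots,\lambda_r),\qquad W:=\widetilde U\,\Lambda\,\widetilde U^{\top}+(I_s-\widetilde U\,\widetilde U^{\top}),$$ and define the final sketching operator $S:=W\Phi\in\mathbb{R}^{s\times m}$. Then, with probability at least $1-\delta$ over the draw of $\Phi$, the following hold. 1. (Constant-factor control and perfect conditioning.) For every $i\in\{1,\dots,r\}$, $$\frac{1-\varepsilon}{\kappa_0}\,\sigma_i(A)\ \le\ \sigma_i(SA)\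 \le\ (1+\varepsilon)\,\kappa_0\,\sigma_i(A),$$ and $\kappa(SA)=1$. 2. (Stability under structured perturbations.) Let $E=U\Delta V^{\top}$ satisfy $\|\Delta\|_2\le\eta\,\sigma_r(A)$ for some $\eta\in(0,1)$, where $A=U\Sigma V^{\top}$ is the thin singular value decomposition. Define $\widehat A:=A+E$. Using the same sketch $S$, $$\bigl|\sigma_i(S\widehat A)-\sigma_i(SA)\bigr|\ \le\ L\,\eta\,\sigma_r(A),\qquad i\in\{1,\dots,r\},$$ where $$L:=\frac{(1+\varepsilon)^2}{1-\varepsilon}\,\kappa_0.$$
   Context: $\sigma_1(M)\ge\sigma_2(M)\ge\cdots$ denote the singular values of a real matrix $M$; $\|\cdot\|_2$ is the Euclidean norm of vectors and the spectral norm of matrices; $I_s$ is the $s\times s$ identity. For a matrix $M$ of rank $r$, $\kappa(M)=\sigma_1(M)/\sigma_r(M)$ is the ratio of its largest to its smallest nonzero singular value. The thin singular value decomposition of a rank-$r$ matrix $M\in\mathbb{R}^{p\times q}$ is $M=U\Sigma V^{\top}$ with $U\in\mathbb{R}^{p\times r}$, $V\in\mathbb{R}^{q\times r}$ having orthonormal columns and $\Sigma=\mathrm{diag}(\sigma_1(M),\dots,\sigma_r(M))$; in item 2, $\Delta\in\mathbb{R}^{r\times r}$. For $A\in\mathbb{R}^{m\times n}$ of rank $r$ and a random sketching matrix $\Phi\in\mathbb{R}^{s\times m}$, a distribution over sketching matrices (chosen independently of the input $A$) is called an oblivious subspace embedding if, with high probability, $$(1-\varepsilon)\|Ax\|_2\le\|\Phi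 Ax\|_2\le(1+\varepsilon)\|Ax\|_2\quad\text{for all }x\in\mathbb{R}^n.$$ A CountSketch transform is a random matrix with exactly one nonzero entry, equal to $\pm1$, per column, placed in a random row with a random sign. An OSNAP transform (Nelson and Nguyen) is a sparse random matrix with a small number $p$ of nonzero entries per column, each equal to $\pm1/\sqrt{p}$, in random rows with random signs. *)

theory Defs
  imports
    "HOL-Probability.Probability_Measure"
    "Jordan_Normal_Form.Char_Poly"
    "Jordan_Normal_Form.DL_Rank"
begin

abbreviation mrank :: "real mat \<Rightarrow> nat" where
  "mrank M \<equiv> vec_space.rank (dim_row M) M"

definition vnorm :: "real vec \<Rightarrow> real" where
  "vnorm x = sqrt (x \<bullet> x)"

definition spectral_norm :: "real mat \<Rightarrow> real" where
  "spectral_norm M = (SUP x \<in> {x \<in> carrier_vec (dim_col M). vnorm x \<le> 1}. vnorm (M *\<^sub>v x))"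

text \<open>
  The singular values of a \<open>p \<times> q\<close> matrix \<open>M\<close> are the square roots of the \<open>q\<close> eigenvalues of
  the positive semidefinite matrix \<open>M\<^sup>T M\<close>, counted with (algebraic) multiplicity and in
  decreasing order. For \<open>p < q\<close> the list ends in \<open>q - p\<close> extra zeros, compared with the convention
  that keeps only \<open>min p q\<close> values.
\<close>

definition sing_vals :: "real mat \<Rightarrow> real list" where
  "sing_vals M = rev (sorted_list_of_multiset (image_mset sqrt (proots (char_poly (M\<^sup>T * M)))))"

text \<open>Indices are one-based: \<open>sing_val M 1\<close> is the largest singular value.\<close>

definition sing_val :: "real mat \<Rightarrow> nat \<Rightarrow> real" where
  "sing_val M i = (if 1 \<le> i \<and> i \<le> length (sing_vals M) then sing_vals M ! (i - 1) else 0)"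

definition cond_number :: "real mat \<Rightarrow> real" where
  "cond_number M = sing_val M 1 / sing_val M (mrank M)"

text \<open>\<open>mat_diag\<close> takes zero-based indices, hence the shift by \<open>Suc\<close> below.\<close>

definition thin_svd :: "real mat \<Rightarrow> real mat \<Rightarrow> real mat \<Rightarrow> real mat \<Rightarrow> bool" where
  "thin_svd M U \<Sigma> V \<longleftrightarrow>
     U \<in> carrier_mat (dim_row M) (mrank M) \<and> U\<^sup>T * U = 1\<^sub>m (mrank M) \<and>
     V \<in> carrier_mat (dim_col M) (mrank M) \<and> V\<^sup>T * V = 1\<^sub>m (mrank M) \<and>
     \<Sigma> = mat_diag (mrank M) (\<lambda>i. sing_val M (Suc i)) \<and>
     M = U * \<Sigma> * V\<^sup>T"

text \<open>The Borel sigma-algebra on \<open>s \<times> m\<close> matrices, generated by the entry maps.\<close>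

definition borel_mat :: "nat \<Rightarrow> nat \<Rightarrow> real mat measure" where
  "borel_mat s m = sigma (carrier_mat s m)
     {{\<Phi> \<in> carrier_mat s m. \<Phi> $$ (i, j) \<in> X} | i j X. i < s \<and> j < m \<and> X \<in> sets borel}"

definition sketching_distribution :: "nat \<Rightarrow> nat \<Rightarrow> real mat measure \<Rightarrow> bool" where
  "sketching_distribution s m D \<longleftrightarrow> prob_space D \<and> sets D = sets (borel_mat s m)"

text \<open>
  A property holds with probability at least \<open>p\<close> if it holds throughout some event of probability
  at least \<open>p\<close>; when the property itself defines an event, this says that this event has
  probability at least \<open>p\<close>.
\<close>

definition holds_with_prob :: "'a measure \<Rightarrow> real \<Rightarrow> ('a \<Rightarrow> bool) \<Rightarrow> bool" where
  "holds_with_prob D p P \<longleftrightarrow> (\<exists>E \<in> sets D. measure D E \<ge> p \<and> (\<forall>\<omega> \<in> E. P \<omega>))"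

text \<open>
  Obliviousness is the order of quantifiers: one distribution \<open>D\<close> serves all \<open>A\<close> of rank \<open>r\<close>.
  The failure probability \<open>\<delta>\<close> makes "with high probability" quantitative.
\<close>

definition oblivious_subspace_embedding ::
  "real \<Rightarrow> real \<Rightarrow> nat \<Rightarrow> nat \<Rightarrow> real mat measure \<Rightarrow> bool" where
  "oblivious_subspace_embedding \<epsilon> \<delta> r m D \<longleftrightarrow>
     (\<forall>n. \<forall>A \<in> carrier_mat m n. mrank A = r \<longrightarrow>
        holds_with_prob D (1 - \<delta>) (\<lambda>\<Phi>. \<forall>x \<in> carrier_vec n.
          (1 - \<epsilon>) * vnorm (A *\<^sub>v x) \<le> vnorm (\<Phi> *\<^sub>v (A *\<^sub>v x)) \<and>
          vnorm (\<Phi> *\<^sub>v (A *\<^sub>v x)) \<le> (1 + \<epsilon>) * vnorm (A *\<^sub>v x)))"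

text \<open>
  At most \<open>p\<close> nonzero entries per column: \<open>p = 1\<close> for CountSketch, \<open>p\<close> small for OSNAP.
\<close>

definition column_sparse :: "nat \<Rightarrow> real mat measure \<Rightarrow> bool" where
  "column_sparse p D \<longleftrightarrow>
     (AE \<Phi> in D. \<forall>j < dim_col \<Phi>. card {i. i < dim_row \<Phi> \<and> \<Phi> $$ (i, j) \<noteq> 0} \<le> p)"

definition sv_geometric_mean :: "real mat \<Rightarrow> real" where
  "sv_geometric_mean B = root (mrank B) (\<Prod>i = 1..mrank B. sing_val B i)"

definition balancing_weight :: "real mat \<Rightarrow> nat \<Rightarrow> real" where
  "balancing_weight B i = sv_geometric_mean B / sing_val B i"

text \<open>Here \<open>U\<close> is the left factor of a thin singular value decomposition of \<open>B\<close>.\<close>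

definition balancing_matrix :: "real mat \<Rightarrow> real mat \<Rightarrow> real mat" where
  "balancing_matrix B U =
     U * mat_diag (mrank B) (\<lambda>i. balancing_weight B (Suc i)) * U\<^sup>T + (1\<^sub>m (dim_row B) - U * U\<^sup>T)"

end

theory Submission
  imports Defs "Jordan_Normal_Form.Schur_Decomposition" "HOL-Combinatorics.Permutations"
begin

text \<open>
  The probability enters only through the embedding event: an oblivious subspace embedding provides,
  for the given \<open>A\<close>, an event of probability at least \<open>1 - \<delta>\<close> on which \<open>\<Phi>\<close> distorts the length of
  every vector in the range of \<open>A\<close> by a factor between \<open>1 - \<epsilon>\<close> and \<open>1 + \<epsilon>\<close>. On that event all the claims
  hold deterministically (\<open>balanced_sketch_of_embedding\<close>).

  Let \<open>B = \<Phi> A\<close>, with thin singular value decomposition \<open>U \<Sigma> V\<^sup>T\<close>, and let \<open>g\<close> be the geometric mean of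
  its singular values. The weights \<open>g / \<sigma>\<^sub>i(B)\<close> cancel \<open>\<Sigma>\<close>, so that \<open>S A = g U V\<^sup>T\<close> has \<open>r\<close> singular values
  equal to \<open>g\<close> and no other positive one (\<open>balanced_sing_vals\<close>); this is perfect conditioning.
  The mean \<open>g\<close> lies between \<open>\<sigma>\<^sub>r(B)\<close> and \<open>\<sigma>\<^sub>1(B)\<close>, the embedding compares these with
  \<open>\<sigma>\<^sub>r(A)\<close> and \<open>\<sigma>\<^sub>1(A)\<close>, and all the singular values of \<open>A\<close> up to index \<open>r\<close> lie within a factor \<open>\<kappa>\<^sub>0\<close> of each
  other; this gives the two-sided bounds.

  For stability, Weyl's inequality (\<open>sing_val_perturbation\<close>) reduces the claim to the size of
  \<open>S E\<close>. The left factor of the perturbation \<open>E\<close> is the left factor of \<open>A\<close>, so the range of \<open>E\<close> lies in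
  that of \<open>A\<close>, where \<open>\<Phi>\<close> stretches by at most \<open>1 + \<epsilon>\<close> and maps into the range of \<open>B\<close>; there the
  balancing stretches by at most the largest weight \<open>g / \<sigma>\<^sub>r(B)\<close>.

  The linear algebra behind this is the spectral theorem for real symmetric matrices, which turns
  singular values, defined through the characteristic polynomial of the Gram matrix, into
  stretching factors along an orthonormal basis. A dimension count then yields
  \<open>sing_val_comparison\<close>: if \<open>M\<close> stretches every vector at most \<open>a\<close> times as much as \<open>N\<close>, up to an additive
  term \<open>c\<close>, then each singular value of \<open>M\<close> is at most \<open>a\<close> times that of \<open>N\<close> plus \<open>c\<close>. This one comparison
  serves for the embedding, for the balanced matrix, for Weyl's inequality and, through
  \<open>sing_val_pos_iff_le_mrank\<close>, for the ranks.
\<close>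

unbundle no vec_syntax
unbundle no inner_syntax

section \<open>The Euclidean norm\<close>

lemma vnorm_nonneg: "0 \<le> vnorm x"
  unfolding vnorm_def scalar_prod_def by (auto intro: sum_nonneg)

lemma vnorm_power2: "(vnorm x)\<^sup>2 = x \<bullet> x"
  unfolding vnorm_def scalar_prod_def by (simp add: sum_nonneg)

lemma vnorm_sum: assumes "x \<in> carrier_vec n" shows "(vnorm x)\<^sup>2 = (\<Sum>i<n. (x $ i)\<^sup>2)"
  using assms unfolding vnorm_power2 scalar_prod_def by (auto simp: power2_eq_square atLeast0LessThan)

lemma vnorm_eq_0_iff: assumes "x \<in> carrier_vec n" shows "vnorm x = 0 \<longleftrightarrow> x = 0\<^sub>v n"
proof -
  have "vnorm x = 0 \<longleftrightarrow> (\<Sum>i<n. (x $ i)\<^sup>2) = 0"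
    using vnorm_sum[OF assms] by (metis power_zero_numeral zero_eq_power2)
  also have "\<dots> \<longleftrightarrow> (\<forall>i<n. x $ i = 0)" by (subst sum_nonneg_eq_0_iff) auto
  also have "\<dots> \<longleftrightarrow> x = 0\<^sub>v n" using assms by (auto simp: vec_eq_iff)
  finally show ?thesis .
qed

lemma vnorm_smult: "vnorm (c \<cdot>\<^sub>v x) = \<bar>c\<bar> * vnorm x"
proof -
  have "(c \<cdot>\<^sub>v x) \<bullet> (c \<cdot>\<^sub>v x) = c\<^sup>2 * (x \<bullet> x)"
    by (auto simp: scalar_prod_def sum_distrib_left power2_eq_square algebra_simps intro!: sum.cong)
  then show ?thesis by (simp add: vnorm_def real_sqrt_mult)
qed

lemma vnorm_triangle:
  assumes "x \<in> carrier_vec n" "y \<in> carrier_vec n"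
  shows "vnorm (x + y) \<le> vnorm x + vnorm y"
proof -
  have eq: "vnorm z = L2_set (\<lambda>i. z $ i) {..<n}" if "z \<in> carrier_vec n" for z
    using vnorm_sum[OF that] vnorm_nonneg[of z] unfolding L2_set_def by (metis real_sqrt_unique)
  have "L2_set (\<lambda>i. (x + y) $ i) {..<n} = L2_set (\<lambda>i. x $ i + y $ i) {..<n}"
    using assms by (intro L2_set_cong) auto
  then show ?thesis using eq assms L2_set_triangle_ineq[of "\<lambda>i. x $ i" "\<lambda>i. y $ i"] by auto
qed

lemma vnorm_orthonormal_cols:
  assumes Q: "Q \<in> carrier_mat n k" "Q\<^sup>T * Q = 1\<^sub>m k" and y: "y \<in> carrier_vec k"
  shows "vnorm (Q *\<^sub>v y) = vnorm y"
proof -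
  have "(Q *\<^sub>v y) \<bullet> (Q *\<^sub>v y) = (Q\<^sup>T *\<^sub>v (Q *\<^sub>v y)) \<bullet> y"
    using Q y by (subst transpose_vec_mult_scalar[of Q n k]) auto
  also have "Q\<^sup>T *\<^sub>v (Q *\<^sub>v y) = y"
    using Q y by (subst assoc_mult_mat_vec[symmetric, of _ k n]) auto
  finally show ?thesis by (simp add: vnorm_def)
qed

text \<open>
  Bessel's inequality: \<open>Q\<^sup>T x\<close> lists the coefficients of the orthogonal projection of \<open>x\<close> to the
  column space, and the squared distance from \<open>x\<close> to that projection is nonnegative.
\<close>

lemma vnorm_orthonormal_cols_transpose_le:
  assumes Q: "Q \<in> carrier_mat n k" "Q\<^sup>T * Q = 1\<^sub>m k" and x: "x \<in> carrier_vec n"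
  shows "vnorm (Q\<^sup>T *\<^sub>v x) \<le> vnorm x"
proof -
  define y where "y = Q\<^sup>T *\<^sub>v x"
  have y: "y \<in> carrier_vec k" using Q x by (auto simp: y_def)
  have Qy: "Q *\<^sub>v y \<in> carrier_vec n" using Q y by auto
  have "0 \<le> (x - Q *\<^sub>v y) \<bullet> (x - Q *\<^sub>v y)"
    using vnorm_power2[of "x - Q *\<^sub>v y"] by (metis zero_le_power2)
  also have "\<dots> = x \<bullet> x - 2 * (x \<bullet> (Q *\<^sub>v y)) + (Q *\<^sub>v y) \<bullet> (Q *\<^sub>v y)"
    using x Qy by (simp add: minus_scalar_prod_distrib[of _ n] scalar_prod_minus_distrib[of _ n]
        comm_scalar_prod[of "Q *\<^sub>v y" n x])
  also have "x \<bullet> (Q *\<^sub>v y) = y \<bullet> y"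
    using transpose_vec_mult_scalar[of Q n k y x] Q x y by (simp add: y_def)
  also have "(Q *\<^sub>v y) \<bullet> (Q *\<^sub>v y) = y \<bullet> y"
    using vnorm_orthonormal_cols[OF Q y] vnorm_power2 by metis
  finally have "(vnorm y)\<^sup>2 \<le> (vnorm x)\<^sup>2" by (simp add: vnorm_power2)
  then show ?thesis using vnorm_nonneg y_def by (meson power2_le_imp_le)
qed

section \<open>Spectral theorem for real symmetric matrices\<close>

text \<open>
  The fundamental theorem of algebra gives a complex eigenvalue \<open>e\<close> with an eigenvector \<open>v\<close>.
  By symmetry the Hermitian form of \<open>A\<close> at \<open>v\<close> is the squared length of \<open>v\<close> times \<open>e\<close> and also times
  the conjugate of \<open>e\<close>, so \<open>e\<close> is real and is a root of the real characteristic polynomial.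
\<close>

lemma symmetric_real_eigenvalue_exists:
  fixes A :: "real mat"
  assumes A: "A \<in> carrier_mat n n" and sym: "A\<^sup>T = A" and n: "n > 0"
  shows "\<exists>e. eigenvalue A e"
proof -
  let ?c = "complex_of_real"
  define Ac where "Ac = map_mat ?c A"
  have Ac: "Ac \<in> carrier_mat n n" using A by (auto simp: Ac_def)
  have symc: "Ac\<^sup>T = Ac" using sym by (metis Ac_def map_mat_transpose)
  have "\<not> constant (poly (char_poly Ac))"
    using degree_monic_char_poly[OF Ac] n by (simp add: constant_degree)
  then obtain e where "poly (char_poly Ac) e = 0" using fundamental_theorem_of_algebra by blast
  then have "eigenvalue Ac e" using eigenvalue_root_char_poly[OF Ac] by blast
  then obtain v where v: "v \<in> carrier_vec n" "v \<noteq> 0\<^sub>v n" "Ac *\<^sub>v v = e \<cdot>\<^sub>v v"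
    using Ac unfolding eigenvalue_def eigenvector_def by auto
  let ?w = "conjugate v"
  have w: "?w \<in> carrier_vec n" using v by auto
  have cw: "Ac *\<^sub>v ?w = conjugate (Ac *\<^sub>v v)"
    using A v(1) by (intro eq_vecI) (auto simp: Ac_def scalar_prod_def)
  have "e * (v \<bullet> ?w) = (Ac *\<^sub>v v) \<bullet> ?w"
    using v by simp
  also have "\<dots> = v \<bullet> (Ac *\<^sub>v ?w)"
    using transpose_vec_mult_scalar[OF Ac w v(1)] symc by simp
  also have "\<dots> = v \<bullet> (cnj e \<cdot>\<^sub>v ?w)"
    using cw v by (simp add: conjugate_smult_vec)
  also have "\<dots> = cnj e * (v \<bullet> ?w)" using v by simp
  finally have "e = cnj e" using conjugate_square_eq_0_vec[OF v(1)] v(2) by auto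
  then have e: "e = ?c (Re e)" by (simp add: complex_eq_iff)
  have "poly (map_poly ?c (char_poly A)) (?c (Re e)) = 0"
    using \<open>poly (char_poly Ac) e = 0\<close> e of_real_hom.char_poly_hom[OF A]
    unfolding Ac_def by metis
  then have "poly (char_poly A) (Re e) = 0"
    by (simp add: of_real_hom.poly_map_poly)
  then show ?thesis using eigenvalue_root_char_poly[OF A] by blast
qed

text \<open>
  Complete \<open>v\<close> to a basis, apply Gram-Schmidt, which leaves the first vector alone, and normalize.
\<close>

lemma orthogonal_mat_with_given_column:
  fixes v :: "real vec"
  assumes v: "v \<in> carrier_vec n" "v \<noteq> 0\<^sub>v n"
  shows "\<exists>W \<in> carrier_mat n n. W\<^sup>T * W = 1\<^sub>m n \<and> col W 0 = (1 / vnorm v) \<cdot>\<^sub>v v"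
proof -
  interpret cof_vec_space n "TYPE(real)" .
  define b where "b = basis_completion v"
  define ws where "ws = gram_schmidt n b"
  note bc = basis_completion[OF v, folded b_def]
  have n: "n > 0" using v by (cases n) auto
  obtain vs where bv: "b = v # vs" using bc(6,7) n by (cases b) auto
  note gs = gram_schmidt_result[OF bc(2,4,5) ws_def]
  have len: "length ws = n" using gs bc by simp
  have hd: "ws ! 0 = v" using gram_schmidt_hd[OF v(1), of vs] len n
    by (simp add: ws_def bv hd_conv_nth[symmetric] del: gram_schmidt_hd) (metis hd_conv_nth length_0_conv not_gr0)
  have wsc: "ws ! i \<in> carrier_vec n" if "i < n" for i using gs len that by auto
  have orth: "ws ! i \<bullet> ws ! j = 0 \<longleftrightarrow> i \<noteq> j" if "i < n" "j < n" for i j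
    using corthogonalD[OF gs(2), of i j] that len by (simp add: conjugate_vec_def vec_eq_iff)
  define W where "W = mat_of_cols n (map (\<lambda>w. (1 / vnorm w) \<cdot>\<^sub>v w) ws)"
  have W: "W \<in> carrier_mat n n" using len by (auto simp: W_def)
  have col: "col W i = (1 / vnorm (ws ! i)) \<cdot>\<^sub>v ws ! i" if "i < n" for i
    using that len wsc unfolding W_def by (subst col_mat_of_cols) auto
  have "W\<^sup>T * W = 1\<^sub>m n"
  proof (rule eq_matI)
    fix i j assume "i < dim_row (1\<^sub>m n :: real mat)" "j < dim_col (1\<^sub>m n :: real mat)"
    then have ij: "i < n" "j < n" by auto
    have "(W\<^sup>T * W) $$ (i, j) = (1 / vnorm (ws ! i)) * (1 / vnorm (ws ! j)) * (ws ! i \<bullet> ws ! j)"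
      using ij W wsc[OF ij(1)] wsc[OF ij(2)] by (simp add: col)
    also have "\<dots> = (if i = j then 1 else 0)"
    proof (cases "i = j")
      case True
      have "ws ! i \<bullet> ws ! i = vnorm (ws ! i) * vnorm (ws ! i)" "ws ! i \<bullet> ws ! i \<noteq> 0"
        using vnorm_power2[of "ws ! i"] orth[OF ij(1) ij(1)] by (auto simp: power2_eq_square)
      then show ?thesis using True by auto
    qed (use orth ij in auto)
    finally show "(W\<^sup>T * W) $$ (i, j) = 1\<^sub>m n $$ (i, j)" using ij by simp
  qed (use W in auto)
  then show ?thesis using W col[OF n] hd by auto
qed

text \<open>
  Induction by deflation: conjugating with an orthogonal matrix whose first column is a unit
  eigenvector clears the first column and, by symmetry, the first row outside the corner. The
  remaining block is again symmetric.
\<close>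

theorem spectral_theorem_symmetric_real:
  fixes A :: "real mat"
  assumes "A \<in> carrier_mat n n" "A\<^sup>T = A"
  shows "\<exists>Q d. Q \<in> carrier_mat n n \<and> Q\<^sup>T * Q = 1\<^sub>m n \<and> Q\<^sup>T * A * Q = mat_diag n d"
  using assms
proof (induction n arbitrary: A)
  case 0
  have "M = N" if "M \<in> carrier_mat 0 0" "N \<in> carrier_mat 0 0" for M N :: "real mat"
    using that by auto
  then show ?case by (intro exI[of _ "1\<^sub>m 0"] exI[of _ "\<lambda>_. 0"]) (use 0 in auto)
next
  case (Suc k A)
  let ?n = "Suc k"
  note A = Suc.prems(1)
  obtain e where "eigenvalue A e"
    using symmetric_real_eigenvalue_exists[OF Suc.prems] by auto
  then obtain v where v: "v \<in> carrier_vec ?n" "v \<noteq> 0\<^sub>v ?n" "A *\<^sub>v v = e \<cdot>\<^sub>v v"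
    using A unfolding eigenvalue_def eigenvector_def by auto
  obtain W where W: "W \<in> carrier_mat ?n ?n" "W\<^sup>T * W = 1\<^sub>m ?n" "col W 0 = (1 / vnorm v) \<cdot>\<^sub>v v"
    using orthogonal_mat_with_given_column[OF v(1,2)] by auto
  define S where "S = W\<^sup>T * A * W"
  have S: "S \<in> carrier_mat ?n ?n" using W A by (auto simp: S_def)
  have symS: "S\<^sup>T = S"
  proof -
    have "S\<^sup>T = W\<^sup>T * (A\<^sup>T * W)"
      unfolding S_def using W A by (simp add: transpose_mult[of _ ?n ?n _ ?n])
    also have "\<dots> = S" unfolding S_def using W A Suc.prems(2) by (simp add: assoc_mult_mat[of _ ?n ?n _ ?n _ ?n])
    finally show ?thesis .
  qed
  have colS: "col S 0 = e \<cdot>\<^sub>v unit_vec ?n 0"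
  proof -
    have Av: "A *\<^sub>v col W 0 = e \<cdot>\<^sub>v col W 0"
      using v A W(3) by (simp add: mult_mat_vec[of A ?n ?n v] smult_smult_assoc mult.commute)
    have "S = W\<^sup>T * (A * W)"
      unfolding S_def using W(1) A by (intro assoc_mult_mat[of _ ?n ?n _ ?n _ ?n]) auto
    also have "col \<dots> 0 = W\<^sup>T *\<^sub>v col (A * W) 0"
      using W(1) A by (intro col_mult2[of _ ?n ?n _ ?n]) auto
    also have "col (A * W) 0 = A *\<^sub>v col W 0"
      using W(1) A by (intro col_mult2[of _ ?n ?n _ ?n]) auto
    finally have "col S 0 = W\<^sup>T *\<^sub>v (A *\<^sub>v col W 0)" .
    also have "W\<^sup>T *\<^sub>v (A *\<^sub>v col W 0) = e \<cdot>\<^sub>v (W\<^sup>T *\<^sub>v col W 0)"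
      unfolding Av using W(1) by (intro mult_mat_vec[of _ ?n ?n]) (auto intro: carrier_vecI)
    also have "W\<^sup>T *\<^sub>v col W 0 = col (W\<^sup>T * W) 0" using W(1) by (subst col_mult2[of _ ?n ?n _ ?n]) auto
    also have "\<dots> = unit_vec ?n 0" using W(2) by simp
    finally show ?thesis .
  qed
  have S0: "S $$ (i, 0) = (if i = 0 then e else 0)" if "i < ?n" for i
    using arg_cong[OF colS, of "\<lambda>v. v $ i"] that S by auto
  have S0': "S $$ (0, i) = (if i = 0 then e else 0)" if "i < ?n" for i
    using S0[OF that] symS S that by (metis carrier_matD index_transpose_mat(1) zero_less_Suc)
  define S3 where "S3 = Matrix.mat k k (\<lambda>(i,j). S $$ (Suc i, Suc j))"
  have S3: "S3 \<in> carrier_mat k k" by (auto simp: S3_def)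
  have "S3\<^sup>T = S3" using symS S
    by (intro eq_matI) (auto simp: S3_def, metis Suc_less_eq carrier_matD index_transpose_mat(1))
  from Suc.IH[OF S3 this] obtain Q3 d where Q3: "Q3 \<in> carrier_mat k k" "Q3\<^sup>T * Q3 = 1\<^sub>m k"
    and d: "Q3\<^sup>T * S3 * Q3 = mat_diag k d" by blast
  let ?e = "Matrix.mat 1 1 (\<lambda>_. e)"
  have Sblock: "S = four_block_mat ?e (0\<^sub>m 1 k) (0\<^sub>m k 1) S3"
    using S by (intro eq_matI) (auto simp: S3_def S0 S0')
  define F where "F = four_block_mat (1\<^sub>m 1) (0\<^sub>m 1 k) (0\<^sub>m k 1) Q3"
  have F: "F \<in> carrier_mat ?n ?n" using Q3 by (auto simp: F_def)
  have FT: "F\<^sup>T = four_block_mat (1\<^sub>m 1) (0\<^sub>m 1 k) (0\<^sub>m k 1) Q3\<^sup>T"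
    unfolding F_def using Q3 by (subst transpose_four_block_mat[of _ 1 1 _ k _ k]) auto
  have "F\<^sup>T * F = four_block_mat (1\<^sub>m 1) (0\<^sub>m 1 k) (0\<^sub>m k 1) (1\<^sub>m k)"
    unfolding FT unfolding F_def using Q3 by (subst mult_four_block_mat[of _ 1 1 _ k _ k _ _ 1 _ k]) auto
  also have "\<dots> = 1\<^sub>m ?n" by (intro eq_matI) auto
  finally have FF: "F\<^sup>T * F = 1\<^sub>m ?n" .
  have "F\<^sup>T * S * F = four_block_mat ?e (0\<^sub>m 1 k) (0\<^sub>m k 1) (mat_diag k d)"
    unfolding FT Sblock unfolding F_def using Q3 S3
    apply (subst mult_four_block_mat[of _ 1 1 _ k _ k _ _ 1 _ k]; simp)
    apply (subst mult_four_block_mat[of _ 1 1 _ k _ k _ _ 1 _ k]; simp add: d)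
    done
  also have "\<dots> = mat_diag ?n (case_nat e d)"
    by (intro eq_matI) (auto simp: mat_diag_def split: nat.split)
  finally have FSF: "F\<^sup>T * S * F = mat_diag ?n (case_nat e d)" .
  define Q where "Q = W * F"
  have Q: "Q \<in> carrier_mat ?n ?n" using W F by (auto simp: Q_def)
  have QT: "Q\<^sup>T = F\<^sup>T * W\<^sup>T" unfolding Q_def using W F by (simp add: transpose_mult[of _ ?n ?n _ ?n])
  have "Q\<^sup>T * Q = F\<^sup>T * (W\<^sup>T * W) * F"
    unfolding QT unfolding Q_def using W(1) F by (simp add: assoc_mult_mat[of _ ?n ?n _ ?n _ ?n])
  also have "\<dots> = 1\<^sub>m ?n" using W F FF by simp
  finally have 1: "Q\<^sup>T * Q = 1\<^sub>m ?n" .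
  have "Q\<^sup>T * A * Q = F\<^sup>T * S * F"
    unfolding QT S_def unfolding Q_def using W(1) F A by (simp add: assoc_mult_mat[of _ ?n ?n _ ?n _ ?n])
  then show ?case using Q 1 FSF by metis
qed

section \<open>Singular values as norms in a right singular basis\<close>

text \<open>
  The columns of \<open>Q\<close> are right singular vectors, ordered in the same way as \<open>sing_vals M\<close>. Column \<open>i\<close>
  belongs to \<open>sing_val M (Suc i)\<close>, because columns are counted from zero.
\<close>

definition right_singular_basis :: "real mat \<Rightarrow> real mat \<Rightarrow> bool" where
  "right_singular_basis M Q \<longleftrightarrow>
     Q \<in> carrier_mat (dim_col M) (dim_col M) \<and> Q\<^sup>T * Q = 1\<^sub>m (dim_col M) \<and>
     Q\<^sup>T * (M\<^sup>T * M) * Q = mat_diag (dim_col M) (\<lambda>i. (sing_val M (Suc i))\<^sup>2)"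

lemma transpose_mult_mult_index:
  fixes X :: "real mat"
  assumes "X \<in> carrier_mat n k" "G \<in> carrier_mat n n" "i < k" "j < k"
  shows "(X\<^sup>T * G * X) $$ (i, j) = col X i \<bullet> (G *\<^sub>v col X j)"
proof -
  have "X\<^sup>T * G * X = X\<^sup>T * (G * X)" using assms by (intro assoc_mult_mat[of _ k n _ n _ k]) auto
  also have "\<dots> $$ (i, j) = row X\<^sup>T i \<bullet> col (G * X) j"
    using assms by (intro index_mult_mat) auto
  also have "col (G * X) j = G *\<^sub>v col X j" using assms by (intro col_mult2[of _ n n _ k]) auto
  finally show ?thesis using assms by simp
qed

lemma sum_list_singleton: "(\<Sum>x\<leftarrow>xs. {#f x#}) = image_mset f (mset xs)"
  by (induction xs) auto

text \<open>
  The values \<open>sing_vals\<close> are read off from the characteristic polynomial of the Gram matrix. Similarity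
  invariance makes that polynomial a product of linear factors with the roots \<open>d i\<close>, and these are
  the squared lengths of the images of the columns of \<open>Q\<close>, hence nonnegative.
\<close>

lemma sing_vals_diagonalization:
  assumes M: "M \<in> carrier_mat p n" and Q: "Q \<in> carrier_mat n n" "Q\<^sup>T * Q = 1\<^sub>m n"
    and d: "Q\<^sup>T * (M\<^sup>T * M) * Q = mat_diag n d"
  shows "mset (sing_vals M) = mset (map (\<lambda>i. sqrt (d i)) [0..<n])"
    and "i < n \<Longrightarrow> 0 \<le> d i"
proof -
  let ?G = "M\<^sup>T * M"
  have G: "?G \<in> carrier_mat n n" using M by auto
  show "0 \<le> d i" if i: "i < n" for i
  proof -
    have "d i = col Q i \<bullet> (?G *\<^sub>v col Q i)"
      using transpose_mult_mult_index[OF Q(1) G i i] i by (simp add: d, simp add: mat_diag_def)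
    also have "?G *\<^sub>v col Q i = M\<^sup>T *\<^sub>v (M *\<^sub>v col Q i)"
      using M Q(1) i by (intro assoc_mult_mat_vec[of _ n p _ n]) (auto intro: carrier_vecI)
    also have "col Q i \<bullet> (M\<^sup>T *\<^sub>v (M *\<^sub>v col Q i)) = (M *\<^sub>v col Q i) \<bullet> (M *\<^sub>v col Q i)"
      using transpose_vec_mult_scalar[of "M\<^sup>T" n p "M *\<^sub>v col Q i" "col Q i"] M Q(1) i
      by (auto intro: carrier_vecI)
    finally show ?thesis using vnorm_power2 by (metis zero_le_power2)
  qed
  have QQ: "Q * Q\<^sup>T = 1\<^sub>m n" using Q mat_mult_left_right_inverse[of "Q\<^sup>T" n Q] by auto
  have "similar_mat_wit (mat_diag n d) ?G Q\<^sup>T Q"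
    by (rule similar_mat_witI[of _ _ n]) (use Q QQ d G in auto)
  then have "char_poly ?G = char_poly (mat_diag n d)"
    using char_poly_similar unfolding similar_mat_def by metis
  also have "\<dots> = (\<Prod>a\<leftarrow>diag_mat (mat_diag n d). [:- a, 1:])"
    by (rule char_poly_upper_triangular[of _ n]) (auto simp: mat_diag_def upper_triangular_def)
  also have "diag_mat (mat_diag n d) = map d [0..<n]"
    by (auto simp: diag_mat_def mat_diag_def)
  finally have cp: "char_poly ?G = (\<Prod>q\<leftarrow>map (\<lambda>a. [:- a, 1:]) (map d [0..<n]). q)" by simp
  have "proots (char_poly ?G) = mset (map d [0..<n])"
    unfolding cp
    by (subst proots_prod_list) (auto simp: o_def simp del: upt.simps intro: sum_list_singleton)
  then show "mset (sing_vals M) = mset (map (\<lambda>i. sqrt (d i)) [0..<n])"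
    unfolding sing_vals_def by (simp add: image_mset.compositionality o_def)
qed

lemma gram_diagonalization_exists:
  fixes M :: "real mat"
  assumes M: "M \<in> carrier_mat p n"
  obtains Q d where "Q \<in> carrier_mat n n" "Q\<^sup>T * Q = 1\<^sub>m n" "Q\<^sup>T * (M\<^sup>T * M) * Q = mat_diag n d"
proof -
  have "M\<^sup>T * M \<in> carrier_mat n n" "(M\<^sup>T * M)\<^sup>T = M\<^sup>T * M"
    using M by (auto simp: transpose_mult[of _ n p _ n])
  then show ?thesis using spectral_theorem_symmetric_real that by blast
qed

lemma length_sing_vals: assumes M: "M \<in> carrier_mat p n" shows "length (sing_vals M) = n"
proof -
  obtain Q d where "Q \<in> carrier_mat n n" "Q\<^sup>T * Q = 1\<^sub>m n" "Q\<^sup>T * (M\<^sup>T * M) * Q = mat_diag n d"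
    using gram_diagonalization_exists[OF M] .
  from sing_vals_diagonalization(1)[OF M this] show ?thesis
    by (metis length_map length_upt minus_nat.diff_0 size_mset)
qed

text \<open>
  The spectral theorem returns eigenvalues in an arbitrary order. The permutation that sorts them is
  applied to the columns of the orthogonal matrix.
\<close>

lemma right_singular_basis_exists: "\<exists>Q. right_singular_basis M Q"
proof -
  define p n where "p = dim_row M" and "n = dim_col M"
  have M: "M \<in> carrier_mat p n" by (auto simp: p_def n_def)
  let ?G = "M\<^sup>T * M"
  have G: "?G \<in> carrier_mat n n" using M by auto
  obtain Q d where Q: "Q \<in> carrier_mat n n" "Q\<^sup>T * Q = 1\<^sub>m n" "Q\<^sup>T * ?G * Q = mat_diag n d"
    using gram_diagonalization_exists[OF M] .
  note sv = sing_vals_diagonalization[OF M Q]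
  obtain \<pi> where \<pi>: "\<pi> permutes {..<n}"
    and perm: "permute_list \<pi> (map (\<lambda>i. sqrt (d i)) [0..<n]) = sing_vals M"
    using mset_eq_permutation[OF sv(1)] by auto
  have \<pi>n: "\<pi> i < n \<longleftrightarrow> i < n" for i using permutes_in_image[OF \<pi>, of i] by auto
  have sq: "(sing_val M (Suc i))\<^sup>2 = d (\<pi> i)" if "i < n" for i
  proof -
    have "sing_val M (Suc i) = sing_vals M ! i"
      using that length_sing_vals[OF M] by (simp add: sing_val_def)
    also have "\<dots> = sqrt (d (\<pi> i))"
      unfolding perm[symmetric] using that \<pi> \<pi>n by (subst permute_list_nth) auto
    finally show ?thesis using sv(2) \<pi>n that by simp
  qed
  define R where "R = Matrix.mat n n (\<lambda>(i,j). Q $$ (i, \<pi> j))"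
  have R: "R \<in> carrier_mat n n" by (auto simp: R_def)
  have colR: "col R j = col Q (\<pi> j)" if "j < n" for j
    using that \<pi>n Q(1) by (intro eq_vecI) (auto simp: R_def)
  have "R\<^sup>T * R = 1\<^sub>m n"
  proof (rule eq_matI)
    fix i j assume "i < dim_row (1\<^sub>m n :: real mat)" "j < dim_col (1\<^sub>m n :: real mat)"
    then have ij: "i < n" "j < n" by auto
    have "(R\<^sup>T * R) $$ (i, j) = (Q\<^sup>T * Q) $$ (\<pi> i, \<pi> j)" using ij R Q(1) \<pi>n by (simp add: colR)
    then show "(R\<^sup>T * R) $$ (i, j) = 1\<^sub>m n $$ (i, j)"
      using ij \<pi>n Q(2) permutes_inj[OF \<pi>] by (simp add: inj_eq)
  qed (use R in auto)
  moreover have "R\<^sup>T * ?G * R = mat_diag n (\<lambda>i. (sing_val M (Suc i))\<^sup>2)"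
  proof (rule eq_matI)
    fix i j assume "i < dim_row (mat_diag n (\<lambda>i. (sing_val M (Suc i))\<^sup>2))"
      "j < dim_col (mat_diag n (\<lambda>i. (sing_val M (Suc i))\<^sup>2))"
    then have ij: "i < n" "j < n" by (auto simp: mat_diag_def)
    have "(R\<^sup>T * ?G * R) $$ (i, j) = (Q\<^sup>T * ?G * Q) $$ (\<pi> i, \<pi> j)"
      using transpose_mult_mult_index[OF R G ij]
        transpose_mult_mult_index[OF Q(1) G, of "\<pi> i" "\<pi> j"] ij \<pi>n by (simp add: colR)
    then show "(R\<^sup>T * ?G * R) $$ (i, j) = mat_diag n (\<lambda>i. (sing_val M (Suc i))\<^sup>2) $$ (i, j)"
      using ij \<pi>n permutes_inj[OF \<pi>] sq unfolding Q(3) by (auto simp: mat_diag_def inj_eq)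
  qed (use R in \<open>auto simp: mat_diag_def\<close>)
  ultimately show ?thesis using R unfolding right_singular_basis_def n_def by auto
qed

lemma sing_val_nonneg: "0 \<le> sing_val M i"
proof -
  have M: "M \<in> carrier_mat (dim_row M) (dim_col M)" by auto
  obtain Q d where Q: "Q \<in> carrier_mat (dim_col M) (dim_col M)" "Q\<^sup>T * Q = 1\<^sub>m (dim_col M)"
      "Q\<^sup>T * (M\<^sup>T * M) * Q = mat_diag (dim_col M) d"
    using gram_diagonalization_exists[OF M] .
  note sv = sing_vals_diagonalization[OF M Q]
  have "set (sing_vals M) = set (map (\<lambda>i. sqrt (d i)) [0..<dim_col M])"
    using sv(1) by (metis set_mset_mset)
  then have "\<forall>x \<in> set (sing_vals M). 0 \<le> x" using sv(2) by auto
  then show ?thesis unfolding sing_val_def by auto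
qed

lemma sing_val_antimono: assumes "1 \<le> i" "i \<le> j" shows "sing_val M j \<le> sing_val M i"
proof (cases "j \<le> length (sing_vals M)")
  case True
  have "sorted_wrt (\<ge>) (sing_vals M)"
    unfolding sing_vals_def by (simp add: sorted_wrt_rev)
  then have "sing_vals M ! (j - 1) \<le> sing_vals M ! (i - 1)" if "i \<noteq> j"
    using True assms that by (intro sorted_wrt_nth_less[where P="(\<ge>)"]) auto
  then show ?thesis using True assms unfolding sing_val_def by (cases "i = j") auto
next
  case False
  then have "sing_val M j = 0" by (simp add: sing_val_def)
  then show ?thesis using sing_val_nonneg by simp
qed

text \<open>
  The link between the algebraic definition of singular values and lengths: the bounds below follow
  from this formula, the orthogonality of \<open>Q\<close>, and the decrease of the singular values.
\<close>

lemma vnorm_right_singular_basis: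
  assumes M: "M \<in> carrier_mat p n" and Q: "right_singular_basis M Q" and y: "y \<in> carrier_vec n"
  shows "(vnorm (M *\<^sub>v (Q *\<^sub>v y)))\<^sup>2 = (\<Sum>i<n. (sing_val M (Suc i))\<^sup>2 * (y $ i)\<^sup>2)"
proof -
  have Q': "Q \<in> carrier_mat n n" "Q\<^sup>T * (M\<^sup>T * M) * Q = mat_diag n (\<lambda>i. (sing_val M (Suc i))\<^sup>2)"
    using Q M unfolding right_singular_basis_def by auto
  let ?x = "Q *\<^sub>v y"
  have x: "?x \<in> carrier_vec n" using Q'(1) y by auto
  have D: "Q\<^sup>T *\<^sub>v (M\<^sup>T *\<^sub>v (M *\<^sub>v ?x)) = mat_diag n (\<lambda>i. (sing_val M (Suc i))\<^sup>2) *\<^sub>v y"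
  proof -
    have "mat_diag n (\<lambda>i. (sing_val M (Suc i))\<^sup>2) *\<^sub>v y = (Q\<^sup>T * (M\<^sup>T * M)) *\<^sub>v ?x"
      unfolding Q'(2)[symmetric] using M Q'(1) y by (intro assoc_mult_mat_vec[of _ n n _ n]) auto
    also have "\<dots> = Q\<^sup>T *\<^sub>v ((M\<^sup>T * M) *\<^sub>v ?x)"
      using M Q'(1) x by (intro assoc_mult_mat_vec[of _ n n _ n]) auto
    also have "(M\<^sup>T * M) *\<^sub>v ?x = M\<^sup>T *\<^sub>v (M *\<^sub>v ?x)"
      using M x by (intro assoc_mult_mat_vec[of _ n p _ n]) auto
    finally show ?thesis by simp
  qed
  have "(vnorm (M *\<^sub>v ?x))\<^sup>2 = (M\<^sup>T *\<^sub>v (M *\<^sub>v ?x)) \<bullet> ?x"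
    unfolding vnorm_power2 using M x by (subst transpose_vec_mult_scalar[of M p n]) auto
  also have "\<dots> = (Q\<^sup>T *\<^sub>v (M\<^sup>T *\<^sub>v (M *\<^sub>v ?x))) \<bullet> y"
    using M Q'(1) x y by (subst transpose_vec_mult_scalar[of Q n n]) auto
  also have "\<dots> = (\<Sum>i<n. (sing_val M (Suc i))\<^sup>2 * (y $ i)\<^sup>2)"
  proof -
    have "(mat_diag n (\<lambda>i. (sing_val M (Suc i))\<^sup>2) *\<^sub>v y) $ i = (sing_val M (Suc i))\<^sup>2 * y $ i" if "i < n" for i
      using that y by (simp add: mat_diag_def scalar_prod_def if_distrib[of "\<lambda>x. x * _"] cong: if_cong)
    then show ?thesis unfolding D
      using y by (simp add: scalar_prod_def atLeast0LessThan power2_eq_square mult.assoc)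
  qed
  finally show ?thesis .
qed

lemma right_singular_basis_coords:
  assumes M: "M \<in> carrier_mat p n" and Q: "right_singular_basis M Q"
  shows "Q \<in> carrier_mat n n" "Q\<^sup>T * Q = 1\<^sub>m n" "x \<in> carrier_vec n \<Longrightarrow> Q *\<^sub>v (Q\<^sup>T *\<^sub>v x) = x"
proof -
  show Q': "Q \<in> carrier_mat n n" "Q\<^sup>T * Q = 1\<^sub>m n" using Q M unfolding right_singular_basis_def by auto
  then have QQ: "Q * Q\<^sup>T = 1\<^sub>m n" using mat_mult_left_right_inverse[of "Q\<^sup>T" n Q] by auto
  show "Q *\<^sub>v (Q\<^sup>T *\<^sub>v x) = x" if "x \<in> carrier_vec n"
    using Q' QQ that by (subst assoc_mult_mat_vec[symmetric, of _ n n _ n]) auto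
qed

lemma vnorm_mult_le_sing_val_1:
  assumes M: "M \<in> carrier_mat p n" and x: "x \<in> carrier_vec n"
  shows "vnorm (M *\<^sub>v x) \<le> sing_val M 1 * vnorm x"
proof -
  obtain Q where Q: "right_singular_basis M Q" using right_singular_basis_exists by blast
  note Qc = right_singular_basis_coords[OF M Q]
  define y where "y = Q\<^sup>T *\<^sub>v x"
  have y: "y \<in> carrier_vec n" and xy: "x = Q *\<^sub>v y" using Qc x by (auto simp: y_def)
  have "(vnorm (M *\<^sub>v x))\<^sup>2 = (\<Sum>i<n. (sing_val M (Suc i))\<^sup>2 * (y $ i)\<^sup>2)"
    unfolding xy by (rule vnorm_right_singular_basis[OF M Q y])
  also have "\<dots> \<le> (\<Sum>i<n. (sing_val M 1)\<^sup>2 * (y $ i)\<^sup>2)"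
    by (intro sum_mono mult_right_mono power_mono sing_val_antimono sing_val_nonneg) auto
  also have "\<dots> = (sing_val M 1 * vnorm x)\<^sup>2"
    unfolding xy vnorm_orthonormal_cols[OF Qc(1,2) y] using vnorm_sum[OF y]
    by (simp add: power_mult_distrib sum_distrib_left)
  finally show ?thesis
    by (rule power2_le_imp_le) (simp add: sing_val_nonneg vnorm_nonneg)
qed

section \<open>Min-max comparison of singular values\<close>

text \<open>
  Padding with zero rows gives a square singular matrix.
\<close>

lemma underdetermined_homogeneous_system:
  fixes P :: "real mat"
  assumes P: "P \<in> carrier_mat j k" and jk: "j < k"
  shows "\<exists>y \<in> carrier_vec k. y \<noteq> 0\<^sub>v k \<and> P *\<^sub>v y = 0\<^sub>v j"
proof -
  define P' where "P' = Matrix.mat k k (\<lambda>(i,l). if i < j then P $$ (i, l) else 0)"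
  have P': "P' \<in> carrier_mat k k" by (auto simp: P'_def)
  have "P'\<^sup>T *\<^sub>v unit_vec k j = 0\<^sub>v k"
  proof (rule eq_vecI)
    fix i assume "i < dim_vec (0\<^sub>v k :: real vec)"
    then show "(P'\<^sup>T *\<^sub>v unit_vec k j) $ i = 0\<^sub>v k $ i"
      using jk by (simp add: P'_def)
  qed (use P' in auto)
  moreover have "unit_vec k j \<noteq> (0\<^sub>v k :: real vec)" using jk by simp
  moreover have "P'\<^sup>T \<in> carrier_mat k k" using P' by simp
  ultimately have "det P'\<^sup>T = 0"
    using det_0_iff_vec_prod_zero_field unit_vec_carrier by blast
  then have "det P' = 0" using det_transpose[OF P'] by simp
  then obtain y where y: "y \<in> carrier_vec k" "y \<noteq> 0\<^sub>v k" "P' *\<^sub>v y = 0\<^sub>v k"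
    using det_0_iff_vec_prod_zero_field[OF P'] by auto
  have "(P *\<^sub>v y) $ i = 0" if "i < j" for i
  proof -
    have "(P *\<^sub>v y) $ i = (P' *\<^sub>v y) $ i"
      using that jk P y(1) by (auto simp: P'_def scalar_prod_def)
    then show ?thesis using y(3) that jk by simp
  qed
  then have "P *\<^sub>v y = 0\<^sub>v j" using P by (intro eq_vecI) auto
  then show ?thesis using y by blast
qed

text \<open>
  The upper half of the min-max principle. The vectors orthogonal to the first \<open>k - 1\<close> right
  singular vectors are stretched by at most \<open>sing_val M k\<close>; being orthogonal to them means \<open>k - 1\<close>
  linear conditions, so every \<open>k\<close>-dimensional space contains such a vector.
\<close>

lemma subspace_meets_trailing_singular_subspace:
  assumes M: "M \<in> carrier_mat p n" and X: "X \<in> carrier_mat n k" "X\<^sup>T * X = 1\<^sub>m k" and k: "1 \<le> k" "k \<le> n"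
  shows "\<exists>y \<in> carrier_vec k. y \<noteq> 0\<^sub>v k \<and> vnorm (M *\<^sub>v (X *\<^sub>v y)) \<le> sing_val M k * vnorm y"
proof -
  obtain Q where Q: "right_singular_basis M Q" using right_singular_basis_exists by blast
  note Qc = right_singular_basis_coords[OF M Q]
  define P where "P = Matrix.mat (k - 1) k (\<lambda>(i,j). (Q\<^sup>T * X) $$ (i, j))"
  have P: "P \<in> carrier_mat (k - 1) k" by (auto simp: P_def)
  obtain y where y: "y \<in> carrier_vec k" "y \<noteq> 0\<^sub>v k" "P *\<^sub>v y = 0\<^sub>v (k - 1)"
    using underdetermined_homogeneous_system[OF P] k by auto
  define z where "z = Q\<^sup>T *\<^sub>v (X *\<^sub>v y)"
  have Xy: "X *\<^sub>v y \<in> carrier_vec n" using X y by auto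
  have z: "z \<in> carrier_vec n" and Qz: "X *\<^sub>v y = Q *\<^sub>v z" using Qc Xy by (auto simp: z_def)
  have z0: "z $ i = 0" if "i < k - 1" for i
  proof -
    have "z = (Q\<^sup>T * X) *\<^sub>v y" unfolding z_def using Qc X y by (subst assoc_mult_mat_vec[of _ n n _ k]) auto
    moreover have "Matrix.row P i = Matrix.row (Q\<^sup>T * X) i"
      using that k X Qc(1) by (intro eq_vecI) (auto simp: P_def)
    ultimately have "z $ i = (P *\<^sub>v y) $ i" using that k X(1) Qc(1) P by simp
    then show ?thesis using y(3) that by simp
  qed
  have "(vnorm (M *\<^sub>v (X *\<^sub>v y)))\<^sup>2 = (\<Sum>i<n. (sing_val M (Suc i))\<^sup>2 * (z $ i)\<^sup>2)"
    unfolding Qz by (rule vnorm_right_singular_basis[OF M Q z])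
  also have "\<dots> \<le> (\<Sum>i<n. (sing_val M k)\<^sup>2 * (z $ i)\<^sup>2)"
  proof (rule sum_mono)
    fix i assume "i \<in> {..<n}"
    show "(sing_val M (Suc i))\<^sup>2 * (z $ i)\<^sup>2 \<le> (sing_val M k)\<^sup>2 * (z $ i)\<^sup>2"
    proof (cases "i < k - 1")
      case False
      then show ?thesis using k
        by (intro mult_right_mono power_mono sing_val_antimono sing_val_nonneg) auto
    qed (simp add: z0)
  qed
  also have "\<dots> = (sing_val M k * vnorm y)\<^sup>2"
  proof -
    have "vnorm z = vnorm y"
      using vnorm_orthonormal_cols[OF Qc(1,2) z] vnorm_orthonormal_cols[OF X y(1)] Qz by simp
    then show ?thesis using vnorm_sum[OF z] by (simp add: power_mult_distrib sum_distrib_left)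
  qed
  finally have "vnorm (M *\<^sub>v (X *\<^sub>v y)) \<le> sing_val M k * vnorm y"
    by (rule power2_le_imp_le) (simp add: sing_val_nonneg vnorm_nonneg)
  then show ?thesis using y by blast
qed

lemma leading_cols_orthonormal:
  fixes Q :: "real mat"
  assumes Q: "Q \<in> carrier_mat n n" "Q\<^sup>T * Q = 1\<^sub>m n" and k: "k \<le> n"
  defines "X \<equiv> Matrix.mat n k (\<lambda>(i,j). Q $$ (i, j))"
  shows "X \<in> carrier_mat n k" "X\<^sup>T * X = 1\<^sub>m k"
    and "y \<in> carrier_vec k \<Longrightarrow> X *\<^sub>v y = Q *\<^sub>v Matrix.vec n (\<lambda>i. if i < k then y $ i else 0)"
proof -
  show X: "X \<in> carrier_mat n k" by (auto simp: X_def)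
  have colX: "col X j = col Q j" if "j < k" for j
    using that k Q(1) by (intro eq_vecI) (auto simp: X_def)
  show "X\<^sup>T * X = 1\<^sub>m k"
  proof (rule eq_matI)
    fix i j assume "i < dim_row (1\<^sub>m k :: real mat)" "j < dim_col (1\<^sub>m k :: real mat)"
    then have ij: "i < k" "j < k" by auto
    have "(X\<^sup>T * X) $$ (i, j) = (Q\<^sup>T * Q) $$ (i, j)" using ij X Q(1) k by (simp add: colX)
    then show "(X\<^sup>T * X) $$ (i, j) = 1\<^sub>m k $$ (i, j)" using ij k Q(2) by simp
  qed (use X in auto)
  assume y: "y \<in> carrier_vec k"
  show "X *\<^sub>v y = Q *\<^sub>v Matrix.vec n (\<lambda>i. if i < k then y $ i else 0)"
  proof (rule eq_vecI)
    fix i assume "i < dim_vec (Q *\<^sub>v Matrix.vec n (\<lambda>i. if i < k then y $ i else 0))"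
    then have i: "i < n" using Q by auto
    have "(Q *\<^sub>v Matrix.vec n (\<lambda>i. if i < k then y $ i else 0)) $ i
        = (\<Sum>j\<in>{0..<n}. Q $$ (i, j) * (if j < k then y $ j else 0))"
      using i Q(1) by (simp add: scalar_prod_def)
    also have "\<dots> = (\<Sum>j\<in>{0..<k}. Q $$ (i, j) * y $ j)"
      using k by (intro sum.mono_neutral_cong_right) auto
    also have "\<dots> = (X *\<^sub>v y) $ i" using i y X by (simp add: scalar_prod_def X_def)
    finally show "(X *\<^sub>v y) $ i = (Q *\<^sub>v Matrix.vec n (\<lambda>i. if i < k then y $ i else 0)) $ i" by simp
  qed (use X Q in auto)
qed

text \<open>
  The lower half of the min-max principle rests on this: on the span of the first \<open>k\<close> right singular
  vectors every stretching factor is at least \<open>sing_val M k\<close>.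
\<close>

lemma vnorm_leading_singular_subspace:
  assumes M: "M \<in> carrier_mat p n" and Q: "right_singular_basis M Q" and k: "k \<le> n"
    and y: "y \<in> carrier_vec k"
  shows "(vnorm (M *\<^sub>v (Matrix.mat n k (\<lambda>(i,j). Q $$ (i, j)) *\<^sub>v y)))\<^sup>2
     = (\<Sum>i<k. (sing_val M (Suc i))\<^sup>2 * (y $ i)\<^sup>2)"
proof -
  note Qc = right_singular_basis_coords[OF M Q]
  let ?y = "Matrix.vec n (\<lambda>i. if i < k then y $ i else 0)"
  have "(vnorm (M *\<^sub>v (Q *\<^sub>v ?y)))\<^sup>2 = (\<Sum>i<n. (sing_val M (Suc i))\<^sup>2 * (?y $ i)\<^sup>2)"
    by (rule vnorm_right_singular_basis[OF M Q]) auto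
  also have "\<dots> = (\<Sum>i<k. (sing_val M (Suc i))\<^sup>2 * (y $ i)\<^sup>2)"
    using k by (intro sum.mono_neutral_cong_right) auto
  finally show ?thesis using leading_cols_orthonormal(3)[OF Qc(1,2) k y] by simp
qed

text \<open>
  The span of the first \<open>k\<close> right singular vectors of \<open>M\<close> contains a vector that \<open>N\<close> stretches by at
  most \<open>sing_val N k\<close>, whereas \<open>M\<close> stretches it by at least \<open>sing_val M k\<close>. The case \<open>a = 1\<close> is Weyl's
  perturbation inequality, the case \<open>c = 0\<close> transfers the bounds of an embedding, and the case \<open>a = 0\<close>
  bounds singular values by an operator norm.
\<close>

theorem sing_val_comparison:
  assumes M: "M \<in> carrier_mat p n" and N: "N \<in> carrier_mat q n" and k: "1 \<le> k" "k \<le> n" and a: "0 \<le> a"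
    and le: "\<And>x. x \<in> carrier_vec n \<Longrightarrow> vnorm (M *\<^sub>v x) \<le> a * vnorm (N *\<^sub>v x) + c * vnorm x"
  shows "sing_val M k \<le> a * sing_val N k + c"
proof -
  obtain Q where Q: "right_singular_basis M Q" using right_singular_basis_exists by blast
  note Qc = right_singular_basis_coords[OF M Q]
  define X where "X = Matrix.mat n k (\<lambda>(i,j). Q $$ (i, j))"
  note X = leading_cols_orthonormal[OF Qc(1,2) k(2), folded X_def]
  obtain y where y: "y \<in> carrier_vec k" "y \<noteq> 0\<^sub>v k"
    and yN: "vnorm (N *\<^sub>v (X *\<^sub>v y)) \<le> sing_val N k * vnorm y"
    using subspace_meets_trailing_singular_subspace[OF N X(1,2) k] by blast
  have Xy: "X *\<^sub>v y \<in> carrier_vec n" using X(1) y by auto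
  have pos: "vnorm y > 0" using y vnorm_nonneg[of y] vnorm_eq_0_iff[of y k] by fastforce
  have "(sing_val M k * vnorm y)\<^sup>2 = (\<Sum>i<k. (sing_val M k)\<^sup>2 * (y $ i)\<^sup>2)"
    using vnorm_sum[OF y(1)] by (simp add: power_mult_distrib sum_distrib_left)
  also have "\<dots> \<le> (\<Sum>i<k. (sing_val M (Suc i))\<^sup>2 * (y $ i)\<^sup>2)"
    by (intro sum_mono mult_right_mono power_mono sing_val_antimono sing_val_nonneg) auto
  also have "\<dots> = (vnorm (M *\<^sub>v (X *\<^sub>v y)))\<^sup>2"
    unfolding X_def by (rule vnorm_leading_singular_subspace[OF M Q k(2) y(1), symmetric])
  finally have "sing_val M k * vnorm y \<le> vnorm (M *\<^sub>v (X *\<^sub>v y))"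
    by (rule power2_le_imp_le) (rule vnorm_nonneg)
  also have "\<dots> \<le> a * vnorm (N *\<^sub>v (X *\<^sub>v y)) + c * vnorm (X *\<^sub>v y)" by (rule le[OF Xy])
  also have "\<dots> \<le> a * (sing_val N k * vnorm y) + c * vnorm y"
    using yN a vnorm_orthonormal_cols[OF X(1,2) y(1)] by (simp add: mult_left_mono)
  also have "\<dots> = (a * sing_val N k + c) * vnorm y" by (simp add: algebra_simps)
  finally show ?thesis using pos by simp
qed

section \<open>Rank and singular values\<close>

text \<open>
  Let \<open>t\<close> be the number of positive singular values and let \<open>X\<close> hold the first \<open>t\<close> right singular
  vectors. The product \<open>M * X\<close> has the same column space as \<open>M\<close>, since \<open>M\<close> annihilates the remaining
  singular vectors, and it is injective, since all the stretching factors on it are positive.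
  Thus the rank is \<open>t\<close>.
\<close>

theorem sing_val_pos_iff_le_mrank:
  assumes i: "1 \<le> i"
  shows "0 < sing_val M i \<longleftrightarrow> i \<le> mrank M"
proof -
  define p n where "p = dim_row M" and "n = dim_col M"
  have M: "M \<in> carrier_mat p n" by (auto simp: p_def n_def)
  define t where "t = (LEAST i. \<not> 0 < sing_val M (Suc i))"
  (* Beyond the list of singular values sing_val is 0 by default, so t exists and t \<le> n. *)
  have out: "\<not> 0 < sing_val M (Suc n)" using length_sing_vals[OF M] by (simp add: sing_val_def)
  then have tn: "t \<le> n" unfolding t_def by (rule Least_le)
  have t1: "0 < sing_val M (Suc i)" if "i < t" for i
    using that not_less_Least[of i "\<lambda>i. \<not> 0 < sing_val M (Suc i)"] unfolding t_def by blast
  have t2: "sing_val M (Suc i) = 0" if "t \<le> i" for i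
  proof -
    have "\<not> 0 < sing_val M (Suc t)" unfolding t_def by (rule LeastI[of _ n]) (rule out)
    then show ?thesis using that sing_val_antimono[of "Suc t" "Suc i" M] sing_val_nonneg[of M "Suc i"] by auto
  qed
  obtain Q where Q: "right_singular_basis M Q" using right_singular_basis_exists by blast
  note Qc = right_singular_basis_coords[OF M Q]
  define X where "X = Matrix.mat n t (\<lambda>(i,j). Q $$ (i, j))"
  note X = leading_cols_orthonormal[OF Qc(1,2) tn, folded X_def]
  define N where "N = M * X"
  have N: "N \<in> carrier_mat p t" using M X(1) by (auto simp: N_def)
  have Nv: "N *\<^sub>v y = M *\<^sub>v (X *\<^sub>v y)" if "y \<in> carrier_vec t" for y
    unfolding N_def using M X(1) that by (intro assoc_mult_mat_vec) auto
  have inj: "y = 0\<^sub>v t" if y: "y \<in> carrier_vec t" "N *\<^sub>v y = 0\<^sub>v p" for y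
  proof -
    have "M *\<^sub>v (X *\<^sub>v y) = 0\<^sub>v p" using Nv[OF y(1)] y(2) by simp
    then have "vnorm (M *\<^sub>v (X *\<^sub>v y)) = 0" using vnorm_eq_0_iff[of "0\<^sub>v p" p] by simp
    then have "(\<Sum>i<t. (sing_val M (Suc i))\<^sup>2 * (y $ i)\<^sup>2) = 0"
      using vnorm_leading_singular_subspace[OF M Q tn y(1), folded X_def] by simp
    then have "\<forall>i<t. (sing_val M (Suc i))\<^sup>2 * (y $ i)\<^sup>2 = 0"
      by (subst (asm) sum_nonneg_eq_0_iff) auto
    then show ?thesis using t1 y(1) by (intro eq_vecI) (auto, metis less_irrefl)
  qed
  interpret V: vec_space "TYPE(real)" p .
  have dist: "distinct (cols N)"
  proof (subst distinct_conv_nth, intro allI impI)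
    fix i j assume ij: "i < length (cols N)" "j < length (cols N)" "i \<noteq> j"
    then have ij': "i < t" "j < t" using N by auto
    show "cols N ! i \<noteq> cols N ! j"
    proof
      assume eq: "cols N ! i = cols N ! j"
      have "N *\<^sub>v (unit_vec t i - unit_vec t j) = N *\<^sub>v unit_vec t i - N *\<^sub>v unit_vec t j"
        using N by (intro mult_minus_distrib_mat_vec) auto
      also have "N *\<^sub>v unit_vec t i = col N i" using N ij' by (intro eq_vecI) auto
      also have "N *\<^sub>v unit_vec t j = col N j" using N ij' by (intro eq_vecI) auto
      also have "col N i - col N j = 0\<^sub>v p" using eq ij ij' N by auto
      finally have "unit_vec t i - unit_vec t j = (0\<^sub>v t :: real vec)" using inj by auto
      then have "(unit_vec t i - unit_vec t j :: real vec) $ i = 0" using ij' by simp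
      then show False using ij' ij(3) by simp
    qed
  qed
  have "V.rank N = t"
  proof (rule V.lin_indpt_full_rank[OF N dist])
    show "V.lin_indpt (set (cols N))"
      using V.lin_depE[OF N _ dist] inj by metis
  qed
  moreover have "V.col_space N = V.col_space M"
  proof -
    have MN: "M *\<^sub>v x \<in> (\<lambda>y. N *\<^sub>v y) ` carrier_vec t" if x: "x \<in> carrier_vec n" for x
    proof -
      define z where "z = Q\<^sup>T *\<^sub>v x"
      have z: "z \<in> carrier_vec n" and xz: "x = Q *\<^sub>v z" using Qc x by (auto simp: z_def)
      define y where "y = Matrix.vec t (\<lambda>i. z $ i)"
      have y: "y \<in> carrier_vec t" by (auto simp: y_def)
      define w where "w = Matrix.vec n (\<lambda>i. if i < t then y $ i else 0)"
      have w: "w \<in> carrier_vec n" by (auto simp: w_def)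
      have "(vnorm (M *\<^sub>v (Q *\<^sub>v (z - w))))\<^sup>2 = (\<Sum>i<n. (sing_val M (Suc i))\<^sup>2 * ((z - w) $ i)\<^sup>2)"
        using z w by (intro vnorm_right_singular_basis[OF M Q]) auto
      also have "\<dots> = 0"
        using tn z w t2 by (intro sum.neutral) (auto simp: w_def y_def)
      finally have "vnorm (M *\<^sub>v (Q *\<^sub>v (z - w))) = 0" by simp
      moreover have "M *\<^sub>v (Q *\<^sub>v (z - w)) \<in> carrier_vec p"
        by (rule carrier_vecI) (use M in simp)
      ultimately have "M *\<^sub>v (Q *\<^sub>v (z - w)) = 0\<^sub>v p" using vnorm_eq_0_iff by blast
      moreover have "M *\<^sub>v (Q *\<^sub>v (z - w)) = M *\<^sub>v (Q *\<^sub>v z) - M *\<^sub>v (Q *\<^sub>v w)"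
        using M Qc(1) z w by (simp add: mult_minus_distrib_mat_vec[of _ n n] mult_minus_distrib_mat_vec[of _ p n])
      ultimately have "M *\<^sub>v (Q *\<^sub>v z) - M *\<^sub>v (Q *\<^sub>v w) = 0\<^sub>v p" by simp
      then have "M *\<^sub>v (Q *\<^sub>v z) = M *\<^sub>v (Q *\<^sub>v w)"
        using M by (auto simp: vec_eq_iff)
      then have "M *\<^sub>v x = N *\<^sub>v y" using Nv[OF y] X(3)[OF y] by (simp add: xz w_def)
      then show ?thesis using y by blast
    qed
    have NM: "N *\<^sub>v y \<in> (\<lambda>x. M *\<^sub>v x) ` carrier_vec n" if "y \<in> carrier_vec t" for y
      using Nv[OF that] X(1) that by auto
    have cN: "V.col_space N = (\<lambda>y. N *\<^sub>v y) ` carrier_vec t"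
      using V.col_space_eq[OF N] N by auto
    have cM: "V.col_space M = (\<lambda>x. M *\<^sub>v x) ` carrier_vec n"
      using V.col_space_eq[OF M] M by auto
    show ?thesis unfolding cN cM by (intro equalityI image_subsetI NM MN)
  qed
  ultimately have "V.rank M = t" unfolding V.rank_def V.col_space_def by simp
  then have "mrank M = t" by (simp add: p_def)
  then show ?thesis using t1[of "i - 1"] t2[of "i - 1"] i by (cases "i \<le> t") auto
qed

lemma mrank_le_dim_col: "mrank M \<le> dim_col M"
  by (rule vec_space.rank_le_nc) auto

lemma mrank_eqI:
  assumes "\<And>i. 1 \<le> i \<Longrightarrow> 0 < sing_val M i \<longleftrightarrow> 0 < sing_val N i"
  shows "mrank M = mrank N"
proof -
  have "i \<le> mrank M \<longleftrightarrow> i \<le> mrank N" if "1 \<le> i" for i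
    using assms[OF that] sing_val_pos_iff_le_mrank[OF that] by simp
  then show ?thesis by (metis le_antisym le_0_eq less_one linorder_not_le order_refl)
qed

lemma sing_val_beyond: "M \<in> carrier_mat p n \<Longrightarrow> n < i \<Longrightarrow> sing_val M i = 0"
  using length_sing_vals[of M p n] by (simp add: sing_val_def)

lemma sing_val_le_of_vnorm_le:
  assumes M: "M \<in> carrier_mat p n" and N: "N \<in> carrier_mat q n" and k: "1 \<le> k" and a: "0 \<le> a"
    and le: "\<And>x. x \<in> carrier_vec n \<Longrightarrow> vnorm (M *\<^sub>v x) \<le> a * vnorm (N *\<^sub>v x)"
  shows "sing_val M k \<le> a * sing_val N k"
proof (cases "k \<le> n")
  case True
  then show ?thesis using sing_val_comparison[OF M N k True a, of 0] le by simp
next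
  case False
  then show ?thesis using sing_val_beyond[OF M] sing_val_beyond[OF N] by simp
qed

section \<open>Perturbation and spectral norm\<close>

theorem sing_val_perturbation:
  assumes M: "M \<in> carrier_mat p n" and F: "F \<in> carrier_mat p n" and k: "1 \<le> k" "k \<le> n"
    and le: "\<And>x. x \<in> carrier_vec n \<Longrightarrow> vnorm (F *\<^sub>v x) \<le> c * vnorm x"
  shows "\<bar>sing_val (M + F) k - sing_val M k\<bar> \<le> c"
proof -
  have MF: "M + F \<in> carrier_mat p n" using M F by auto
  have add: "(M + F) *\<^sub>v x = M *\<^sub>v x + F *\<^sub>v x" if "x \<in> carrier_vec n" for x
    using add_mult_distrib_mat_vec[OF M F that] .
  have "sing_val (M + F) k \<le> 1 * sing_val M k + c"
  proof (rule sing_val_comparison[OF MF M k])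
    fix x :: "real vec" assume x: "x \<in> carrier_vec n"
    have "vnorm ((M + F) *\<^sub>v x) \<le> vnorm (M *\<^sub>v x) + vnorm (F *\<^sub>v x)"
      unfolding add[OF x] using M F x by (intro vnorm_triangle[of _ p]) auto
    then show "vnorm ((M + F) *\<^sub>v x) \<le> 1 * vnorm (M *\<^sub>v x) + c * vnorm x" using le[OF x] by simp
  qed simp
  moreover have "sing_val M k \<le> 1 * sing_val (M + F) k + c"
  proof (rule sing_val_comparison[OF M MF k])
    fix x :: "real vec" assume x: "x \<in> carrier_vec n"
    have "M *\<^sub>v x = (M + F) *\<^sub>v x + (- 1) \<cdot>\<^sub>v (F *\<^sub>v x)"
      unfolding add[OF x] using M F x by (intro eq_vecI) auto
    then have "vnorm (M *\<^sub>v x) = vnorm ((M + F) *\<^sub>v x + (- 1) \<cdot>\<^sub>v (F *\<^sub>v x))" by simp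
    also have "\<dots> \<le> vnorm ((M + F) *\<^sub>v x) + vnorm ((- 1) \<cdot>\<^sub>v (F *\<^sub>v x))"
      using mult_mat_vec_carrier[OF MF x] mult_mat_vec_carrier[OF F x] by (intro vnorm_triangle[of _ p]) auto
    finally show "vnorm (M *\<^sub>v x) \<le> 1 * vnorm ((M + F) *\<^sub>v x) + c * vnorm x"
      using le[OF x] by (simp add: vnorm_smult)
  qed simp
  ultimately show ?thesis by linarith
qed

lemma vnorm_mult_le_spectral_norm:
  assumes M: "M \<in> carrier_mat p n" and x: "x \<in> carrier_vec n"
  shows "vnorm (M *\<^sub>v x) \<le> spectral_norm M * vnorm x"
proof (cases "vnorm x = 0")
  case True
  then show ?thesis using vnorm_mult_le_sing_val_1[OF M x] by simp
next
  case False
  then have pos: "vnorm x > 0" using vnorm_nonneg[of x] by simp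
  let ?B = "{x \<in> carrier_vec (dim_col M). vnorm x \<le> 1}"
  have bdd: "bdd_above ((\<lambda>x. vnorm (M *\<^sub>v x)) ` ?B)"
  proof (rule bdd_aboveI2)
    fix y :: "real vec" assume "y \<in> ?B"
    then have y: "y \<in> carrier_vec n" "vnorm y \<le> 1" using M by auto
    have "vnorm (M *\<^sub>v y) \<le> sing_val M 1 * vnorm y" by (rule vnorm_mult_le_sing_val_1[OF M y(1)])
    also have "\<dots> \<le> sing_val M 1 * 1" using y(2) sing_val_nonneg by (intro mult_left_mono) auto
    finally show "vnorm (M *\<^sub>v y) \<le> sing_val M 1 * 1" .
  qed
  define u where "u = (1 / vnorm x) \<cdot>\<^sub>v x"
  have u: "u \<in> ?B" using x pos M by (auto simp: u_def vnorm_smult)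
  have "M *\<^sub>v u = (1 / vnorm x) \<cdot>\<^sub>v (M *\<^sub>v x)" unfolding u_def by (rule mult_mat_vec[OF M x])
  then have "vnorm (M *\<^sub>v x) = vnorm (M *\<^sub>v u) * vnorm x" using pos by (simp add: vnorm_smult)
  also have "\<dots> \<le> spectral_norm M * vnorm x"
    unfolding spectral_norm_def using pos cSUP_upper[OF u bdd] by (intro mult_right_mono) auto
  finally show ?thesis .
qed

section \<open>Balancing through a thin singular value decomposition\<close>

lemma mat_diag_mult_vec: "y \<in> carrier_vec r \<Longrightarrow> mat_diag r f *\<^sub>v y = Matrix.vec r (\<lambda>i. f i * y $ i)"
  by (intro eq_vecI)
    (auto simp: mat_diag_def scalar_prod_def if_distrib[of "\<lambda>x. x * _"] cong: if_cong)

lemma thin_svdD: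
  assumes "thin_svd M U \<Sigma> V" and M: "M \<in> carrier_mat p n" and r: "mrank M = r"
  shows "U \<in> carrier_mat p r" "U\<^sup>T * U = 1\<^sub>m r" "V \<in> carrier_mat n r" "V\<^sup>T * V = 1\<^sub>m r"
    and "x \<in> carrier_vec n \<Longrightarrow> M *\<^sub>v x = U *\<^sub>v Matrix.vec r (\<lambda>i. sing_val M (Suc i) * (V\<^sup>T *\<^sub>v x) $ i)"
proof -
  have dims: "dim_row M = p" "dim_col M = n" using M by auto
  note svd = assms(1)[unfolded thin_svd_def, unfolded r, unfolded dims]
  then have D: "\<Sigma> = mat_diag r (\<lambda>i. sing_val M (Suc i))" and Meq: "M = U * \<Sigma> * V\<^sup>T"
    by blast+
  show U: "U \<in> carrier_mat p r" "U\<^sup>T * U = 1\<^sub>m r" and V: "V \<in> carrier_mat n r" "V\<^sup>T * V = 1\<^sub>m r"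
    using svd by blast+
  assume x: "x \<in> carrier_vec n"
  have S: "\<Sigma> \<in> carrier_mat r r" by (simp add: D)
  have Vx: "V\<^sup>T *\<^sub>v x \<in> carrier_vec r" using V x by auto
  have "M *\<^sub>v x = (U * \<Sigma>) *\<^sub>v (V\<^sup>T *\<^sub>v x)"
    using U S V x by (subst Meq, intro assoc_mult_mat_vec[of _ p r _ n]) auto
  also have "\<dots> = U *\<^sub>v (\<Sigma> *\<^sub>v (V\<^sup>T *\<^sub>v x))"
    using U S Vx by (intro assoc_mult_mat_vec[of _ p r _ r]) auto
  finally show "M *\<^sub>v x = U *\<^sub>v Matrix.vec r (\<lambda>i. sing_val M (Suc i) * (V\<^sup>T *\<^sub>v x) $ i)"
    unfolding D using Vx by (simp add: mat_diag_mult_vec)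
qed

lemma balancing_matrix_carrier:
  assumes "U \<in> carrier_mat (dim_row B) (mrank B)"
  shows "balancing_matrix B U \<in> carrier_mat (dim_row B) (dim_row B)"
  using assms by (auto simp: balancing_matrix_def)

text \<open>
  On the column space of \<open>U\<close> the projection onto the orthogonal complement vanishes and only the
  diagonal weights act.
\<close>

lemma balancing_matrix_mult_range:
  assumes B: "B \<in> carrier_mat p n" and r: "mrank B = r"
    and U: "U \<in> carrier_mat p r" "U\<^sup>T * U = 1\<^sub>m r" and z: "z \<in> carrier_vec r"
  shows "balancing_matrix B U *\<^sub>v (U *\<^sub>v z) = U *\<^sub>v Matrix.vec r (\<lambda>i. balancing_weight B (Suc i) * z $ i)"
proof -
  let ?L = "mat_diag r (\<lambda>i. balancing_weight B (Suc i))"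
  have Uz: "U *\<^sub>v z \<in> carrier_vec p" using U z by auto
  have UUz: "U\<^sup>T *\<^sub>v (U *\<^sub>v z) = z"
    using U z by (subst assoc_mult_mat_vec[symmetric, of _ r p _ r]) auto
  have "(U * ?L * U\<^sup>T) *\<^sub>v (U *\<^sub>v z) = (U * ?L) *\<^sub>v (U\<^sup>T *\<^sub>v (U *\<^sub>v z))"
    using U Uz by (intro assoc_mult_mat_vec[of _ p r _ p]) auto
  also have "\<dots> = U *\<^sub>v (?L *\<^sub>v z)"
    unfolding UUz using U z by (intro assoc_mult_mat_vec[of _ p r _ r]) auto
  finally have 1: "(U * ?L * U\<^sup>T) *\<^sub>v (U *\<^sub>v z) = U *\<^sub>v (?L *\<^sub>v z)" .
  have "(1\<^sub>m p - U * U\<^sup>T) *\<^sub>v (U *\<^sub>v z) = 1\<^sub>m p *\<^sub>v (U *\<^sub>v z) - (U * U\<^sup>T) *\<^sub>v (U *\<^sub>v z)"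
    using U Uz by (intro minus_mult_distrib_mat_vec[of _ p p]) auto
  also have "(U * U\<^sup>T) *\<^sub>v (U *\<^sub>v z) = U *\<^sub>v z"
    using U Uz UUz by (subst assoc_mult_mat_vec[of _ p r _ p]) auto
  finally have 2: "(1\<^sub>m p - U * U\<^sup>T) *\<^sub>v (U *\<^sub>v z) = 0\<^sub>v p" using Uz by simp
  have "balancing_matrix B U *\<^sub>v (U *\<^sub>v z) = (U * ?L * U\<^sup>T) *\<^sub>v (U *\<^sub>v z) + (1\<^sub>m p - U * U\<^sup>T) *\<^sub>v (U *\<^sub>v z)"
    unfolding balancing_matrix_def r using B U Uz
    by (simp, intro add_mult_distrib_mat_vec[of _ p p]) auto
  also have "\<dots> = U *\<^sub>v (?L *\<^sub>v z)"
    unfolding 1 2 by (rule right_zero_vec) (rule carrier_vecI, use U in simp)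
  finally show ?thesis using z by (simp add: mat_diag_mult_vec)
qed

lemma sv_geometric_mean_bounds:
  assumes r: "mrank B = r" "1 \<le> r"
  shows "sing_val B r \<le> sv_geometric_mean B" "sv_geometric_mean B \<le> sing_val B 1"
proof -
  have "(\<Prod>i = 1..r. sing_val B r) \<le> (\<Prod>i = 1..r. sing_val B i)"
    by (intro prod_mono) (auto simp: sing_val_nonneg sing_val_antimono)
  then have "root r (sing_val B r ^ r) \<le> sv_geometric_mean B"
    unfolding sv_geometric_mean_def r(1) using r(2) by simp
  then show "sing_val B r \<le> sv_geometric_mean B"
    using r(2) by (simp add: real_root_power_cancel sing_val_nonneg)
  have "(\<Prod>i = 1..r. sing_val B i) \<le> (\<Prod>i = 1..r. sing_val B 1)"
    by (intro prod_mono) (auto simp: sing_val_nonneg intro: sing_val_antimono[of 1, simplified])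
  then have "sv_geometric_mean B \<le> root r (sing_val B 1 ^ r)"
    unfolding sv_geometric_mean_def r(1) using r(2) by simp
  then show "sv_geometric_mean B \<le> sing_val B 1"
    using r(2) by (simp add: real_root_power_cancel sing_val_nonneg)
qed

text \<open>
  The weight of index \<open>i\<close> is \<open>g / \<sigma>\<^sub>i\<close> for the geometric mean \<open>g\<close>, so it cancels \<open>\<sigma>\<^sub>i\<close> and the
  balanced matrix is \<open>g U V\<^sup>T\<close>. The second bound says that no weight exceeds \<open>g / \<sigma>\<^sub>r\<close>.
\<close>

lemma balanced_vnorm:
  assumes B: "B \<in> carrier_mat p n" and r: "mrank B = r" "1 \<le> r"
    and svd: "thin_svd B U \<Sigma> V" and x: "x \<in> carrier_vec n"
  shows "vnorm (balancing_matrix B U *\<^sub>v (B *\<^sub>v x)) = sv_geometric_mean B * vnorm (V\<^sup>T *\<^sub>v x)"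
    and "vnorm (balancing_matrix B U *\<^sub>v (B *\<^sub>v x)) \<le> sv_geometric_mean B / sing_val B r * vnorm (B *\<^sub>v x)"
proof -
  note s = thin_svdD[OF svd B r(1)]
  let ?g = "sv_geometric_mean B"
  let ?z = "Matrix.vec r (\<lambda>i. sing_val B (Suc i) * (V\<^sup>T *\<^sub>v x) $ i)"
  have pos: "sing_val B (Suc i) > 0" if "i < r" for i
    using that r sing_val_pos_iff_le_mrank[of "Suc i" B] by simp
  have posr: "sing_val B r > 0" using pos[of "r - 1"] r(2) by simp
  have g: "?g > 0" using sv_geometric_mean_bounds(1)[OF r] posr by simp
  have Bx: "B *\<^sub>v x = U *\<^sub>v ?z" by (rule s(5)[OF x])
  have Vx: "V\<^sup>T *\<^sub>v x \<in> carrier_vec r" using s(3) x by auto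
  define w where "w = Matrix.vec r (\<lambda>i. balancing_weight B (Suc i) * ?z $ i)"
  have WBx: "balancing_matrix B U *\<^sub>v (B *\<^sub>v x) = U *\<^sub>v w"
    unfolding Bx w_def by (rule balancing_matrix_mult_range[OF B r(1) s(1,2)]) simp
  have w: "w = ?g \<cdot>\<^sub>v (V\<^sup>T *\<^sub>v x)"
  proof -
    define v where "v = V\<^sup>T *\<^sub>v x"
    have "v \<in> carrier_vec r" using Vx by (simp add: v_def)
    moreover have "sing_val B (Suc i) \<noteq> 0" if "i < r" for i using pos[OF that] by simp
    ultimately show ?thesis
      unfolding w_def v_def[symmetric] by (intro eq_vecI) (auto simp: balancing_weight_def)
  qed
  have norm_w: "vnorm (U *\<^sub>v w) = ?g * vnorm (V\<^sup>T *\<^sub>v x)"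
    using vnorm_orthonormal_cols[OF s(1,2), of w] Vx g by (simp add: w vnorm_smult)
  then show "vnorm (balancing_matrix B U *\<^sub>v (B *\<^sub>v x)) = ?g * vnorm (V\<^sup>T *\<^sub>v x)"
    by (simp add: WBx)
  have "(sing_val B r * vnorm (V\<^sup>T *\<^sub>v x))\<^sup>2 = (\<Sum>i<r. (sing_val B r)\<^sup>2 * ((V\<^sup>T *\<^sub>v x) $ i)\<^sup>2)"
    unfolding power_mult_distrib vnorm_sum[OF Vx] by (simp add: sum_distrib_left)
  also have "\<dots> \<le> (\<Sum>i<r. (sing_val B (Suc i))\<^sup>2 * ((V\<^sup>T *\<^sub>v x) $ i)\<^sup>2)"
    by (intro sum_mono mult_right_mono power_mono sing_val_antimono sing_val_nonneg) auto
  also have "\<dots> = (vnorm ?z)\<^sup>2"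
    by (subst vnorm_sum[of _ r]) (auto simp: power_mult_distrib)
  also have "vnorm ?z = vnorm (B *\<^sub>v x)"
    unfolding Bx by (rule vnorm_orthonormal_cols[OF s(1,2), symmetric]) simp
  finally have "sing_val B r * vnorm (V\<^sup>T *\<^sub>v x) \<le> vnorm (B *\<^sub>v x)"
    by (rule power2_le_imp_le) (rule vnorm_nonneg)
  then have "?g * (sing_val B r * vnorm (V\<^sup>T *\<^sub>v x)) \<le> ?g * vnorm (B *\<^sub>v x)"
    using g by simp
  then show "vnorm (balancing_matrix B U *\<^sub>v (B *\<^sub>v x)) \<le> ?g / sing_val B r * vnorm (B *\<^sub>v x)"
    unfolding WBx norm_w using posr by (simp add: field_simps)
qed

text \<open>
  By the previous lemma the balanced matrix acts as \<open>g\<close> times an isometry on the range of \<open>V\<close> and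
  contracts to at most \<open>g\<close> everywhere, so its first \<open>r\<close> singular values are \<open>g\<close>. Dominance
  by a multiple of \<open>B\<close> prevents any further positive singular value.
\<close>

theorem balanced_sing_vals:
  assumes B: "B \<in> carrier_mat p n" and r: "mrank B = r" "1 \<le> r" and svd: "thin_svd B U \<Sigma> V"
  shows "\<And>k. 1 \<le> k \<Longrightarrow> k \<le> r \<Longrightarrow> sing_val (balancing_matrix B U * B) k = sv_geometric_mean B"
    and "mrank (balancing_matrix B U * B) = r"
proof -
  let ?W = "balancing_matrix B U" and ?g = "sv_geometric_mean B"
  note s = thin_svdD[OF svd B r(1)]
  have W: "?W \<in> carrier_mat p p" using balancing_matrix_carrier[of U B] B s(1) r(1) by simp
  have WB: "?W * B \<in> carrier_mat p n" using W B by simp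
  have WBv: "(?W * B) *\<^sub>v x = ?W *\<^sub>v (B *\<^sub>v x)" if "x \<in> carrier_vec n" for x
    using W B that by (intro assoc_mult_mat_vec) auto
  have rn: "r \<le> n" using mrank_le_dim_col[of B] B r by simp
  have posr: "sing_val B r > 0" using sing_val_pos_iff_le_mrank[of r B] r by simp
  have g: "?g > 0" using sv_geometric_mean_bounds(1)[OF r] posr by simp
  have le: "sing_val (?W * B) k \<le> ?g" if k: "1 \<le> k" "k \<le> n" for k
  proof -
    (* The factor 0 makes the comparison one with g times the identity. *)
    have "sing_val (?W * B) k \<le> 0 * sing_val (?W * B) k + ?g"
    proof (rule sing_val_comparison[OF WB WB k])
      fix x :: "real vec" assume x: "x \<in> carrier_vec n"
      show "vnorm ((?W * B) *\<^sub>v x) \<le> 0 * vnorm ((?W * B) *\<^sub>v x) + ?g * vnorm x"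
        using vnorm_orthonormal_cols_transpose_le[OF s(3,4) x] g
        by (simp add: WBv[OF x] balanced_vnorm(1)[OF B r svd x])
    qed simp
    then show ?thesis by simp
  qed
  have ge: "?g \<le> sing_val (?W * B) r"
  proof -
    obtain y where y: "y \<in> carrier_vec r" "y \<noteq> 0\<^sub>v r"
      and yle: "vnorm ((?W * B) *\<^sub>v (V *\<^sub>v y)) \<le> sing_val (?W * B) r * vnorm y"
      using subspace_meets_trailing_singular_subspace[OF WB s(3,4) r(2) rn] by blast
    have pos: "vnorm y > 0" using y vnorm_nonneg[of y] vnorm_eq_0_iff[of y r] by fastforce
    have Vy: "V *\<^sub>v y \<in> carrier_vec n" using s(3) y by auto
    have "V\<^sup>T *\<^sub>v (V *\<^sub>v y) = y"
      using s(3,4) y(1) by (subst assoc_mult_mat_vec[symmetric, of _ r n _ r]) auto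
    then have "?g * vnorm y \<le> sing_val (?W * B) r * vnorm y"
      using yle by (simp add: WBv[OF Vy] balanced_vnorm(1)[OF B r svd Vy])
    then show ?thesis using pos by simp
  qed
  show sv: "sing_val (?W * B) k = ?g" if "1 \<le> k" "k \<le> r" for k
    using le[of k] ge sing_val_antimono[OF that, of "?W * B"] that rn by simp
  have "0 < sing_val (?W * B) k \<longleftrightarrow> 0 < sing_val B k" if k: "1 \<le> k" for k
  proof (cases "k \<le> r")
    case True
    then show ?thesis using sv[OF k True] g sing_val_pos_iff_le_mrank[OF k, of B] r by simp
  next
    case False
    then have "sing_val B k = 0"
      using sing_val_pos_iff_le_mrank[OF k, of B] r sing_val_nonneg[of B k] by simp
    moreover have "sing_val (?W * B) k \<le> ?g / sing_val B r * sing_val B k"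
      using g posr balanced_vnorm(2)[OF B r svd]
      by (intro sing_val_le_of_vnorm_le[OF WB B k]) (auto simp: WBv)
    ultimately show ?thesis by simp
  qed
  then show "mrank (?W * B) = r" using mrank_eqI[of "?W * B" B] r(1) by simp
qed

section \<open>Sketching by a subspace embedding\<close>

lemma embedding_sing_vals:
  assumes A: "A \<in> carrier_mat m n" and B: "B \<in> carrier_mat s n" and \<epsilon>: "0 < \<epsilon>" "\<epsilon> < 1"
    and emb: "\<forall>x \<in> carrier_vec n.
      (1 - \<epsilon>) * vnorm (A *\<^sub>v x) \<le> vnorm (B *\<^sub>v x) \<and> vnorm (B *\<^sub>v x) \<le> (1 + \<epsilon>) * vnorm (A *\<^sub>v x)"
  shows "\<And>k. 1 \<le> k \<Longrightarrow> (1 - \<epsilon>) * sing_val A k \<le> sing_val B k"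
    and "\<And>k. 1 \<le> k \<Longrightarrow> sing_val B k \<le> (1 + \<epsilon>) * sing_val A k"
    and "mrank B = mrank A"
proof -
  show up: "sing_val B k \<le> (1 + \<epsilon>) * sing_val A k" if "1 \<le> k" for k
    using \<epsilon> emb by (intro sing_val_le_of_vnorm_le[OF B A that]) auto
  show lo: "(1 - \<epsilon>) * sing_val A k \<le> sing_val B k" if "1 \<le> k" for k
  proof -
    have "sing_val A k \<le> 1 / (1 - \<epsilon>) * sing_val B k"
      using \<epsilon> emb by (intro sing_val_le_of_vnorm_le[OF A B that]) (auto simp: field_simps)
    then show ?thesis using \<epsilon> by (simp add: field_simps)
  qed
  show "mrank B = mrank A"
  proof (rule mrank_eqI)
    fix i :: nat assume i: "1 \<le> i"
    have "0 < sing_val B i" if "0 < sing_val A i"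
      using lo[OF i] mult_pos_pos[of "1 - \<epsilon>" "sing_val A i"] that \<epsilon> by linarith
    moreover have "0 < sing_val A i" if "0 < sing_val B i"
      using up[OF i] that \<epsilon> zero_less_mult_pos[of "1 + \<epsilon>" "sing_val A i"] by linarith
    ultimately show "0 < sing_val B i \<longleftrightarrow> 0 < sing_val A i" by blast
  qed
qed

text \<open>
  Dividing the coefficients by the singular values of \<open>A\<close> gives the preimage. It is what lets the
  embedding bounds, which speak of the range of \<open>A\<close> only, apply to the perturbation
  \<open>U \<Delta> V\<^sup>T\<close>.
\<close>

lemma structured_perturbation_in_range:
  assumes A: "A \<in> carrier_mat m n" and r: "mrank A = r" and svd: "thin_svd A U \<Sigma> V" and u: "u \<in> carrier_vec r"
  shows "\<exists>y \<in> carrier_vec n. A *\<^sub>v y = U *\<^sub>v u"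
proof -
  note s = thin_svdD[OF svd A r]
  define w where "w = Matrix.vec r (\<lambda>i. u $ i / sing_val A (Suc i))"
  have w: "w \<in> carrier_vec r" by (simp add: w_def)
  have Vw: "V *\<^sub>v w \<in> carrier_vec n" using s(3) w by auto
  have "V\<^sup>T *\<^sub>v (V *\<^sub>v w) = w"
    using s(3,4) w by (subst assoc_mult_mat_vec[symmetric, of _ r n _ r]) auto
  moreover have "sing_val A (Suc i) \<noteq> 0" if "i < r" for i
    using that r sing_val_pos_iff_le_mrank[of "Suc i" A] by simp
  then have "Matrix.vec r (\<lambda>i. sing_val A (Suc i) * w $ i) = u"
    using u by (intro eq_vecI) (auto simp: w_def)
  ultimately have "A *\<^sub>v (V *\<^sub>v w) = U *\<^sub>v u" using s(5)[OF Vw] by simp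
  then show ?thesis using Vw by blast
qed

text \<open>
  The deterministic part of the result. Items 1 and 2 follow from
  \<open>(1 - \<epsilon>) \<sigma>\<^sub>r(A) \<le> \<sigma>\<^sub>r(B) \<le> g \<le> \<sigma>\<^sub>1(B) \<le> (1 + \<epsilon>) \<kappa> \<sigma>\<^sub>r(A)\<close>. In the constant of item 2, one factor
  \<open>1 + \<epsilon>\<close> together with \<open>\<kappa> / (1 - \<epsilon>)\<close> bounds the largest weight \<open>g / \<sigma>\<^sub>r(B)\<close>, and the other factor
  \<open>1 + \<epsilon>\<close> bounds the norm of \<open>\<Phi>\<close> on the range of \<open>A\<close>.
\<close>

theorem balanced_sketch_of_embedding:
  assumes A: "A \<in> carrier_mat m n" and \<Phi>: "\<Phi> \<in> carrier_mat s m"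
    and r: "mrank A = r" "1 \<le> r" and cond: "cond_number A \<le> \<kappa>" and \<epsilon>: "0 < \<epsilon>" "\<epsilon> < 1"
    and emb: "\<forall>x \<in> carrier_vec n.
          (1 - \<epsilon>) * vnorm (A *\<^sub>v x) \<le> vnorm (\<Phi> *\<^sub>v (A *\<^sub>v x)) \<and>
          vnorm (\<Phi> *\<^sub>v (A *\<^sub>v x)) \<le> (1 + \<epsilon>) * vnorm (A *\<^sub>v x)"
  shows "mrank (\<Phi> * A) = r" and "0 < sing_val (\<Phi> * A) r"
    and "\<And>U\<^sub>B \<Sigma>\<^sub>B V\<^sub>B S i. thin_svd (\<Phi> * A) U\<^sub>B \<Sigma>\<^sub>B V\<^sub>B \<Longrightarrow> S = balancing_matrix (\<Phi> * A) U\<^sub>B * \<Phi> \<Longrightarrow>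
      i \<in> {1..r} \<Longrightarrow> (1 - \<epsilon>) / \<kappa> * sing_val A i \<le> sing_val (S * A) i \<and>
            sing_val (S * A) i \<le> (1 + \<epsilon>) * \<kappa> * sing_val A i"
    and "\<And>U\<^sub>B \<Sigma>\<^sub>B V\<^sub>B S. thin_svd (\<Phi> * A) U\<^sub>B \<Sigma>\<^sub>B V\<^sub>B \<Longrightarrow> S = balancing_matrix (\<Phi> * A) U\<^sub>B * \<Phi> \<Longrightarrow>
      cond_number (S * A) = 1"
    and "\<And>U\<^sub>B \<Sigma>\<^sub>B V\<^sub>B S U \<Sigma> V \<Delta> \<eta> i. thin_svd (\<Phi> * A) U\<^sub>B \<Sigma>\<^sub>B V\<^sub>B \<Longrightarrow>
      S = balancing_matrix (\<Phi> * A) U\<^sub>B * \<Phi> \<Longrightarrow> thin_svd A U \<Sigma> V \<Longrightarrow> \<Delta> \<in> carrier_mat r r \<Longrightarrow>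
      spectral_norm \<Delta> \<le> \<eta> * sing_val A r \<Longrightarrow> i \<in> {1..r} \<Longrightarrow>
      \<bar>sing_val (S * (A + U * \<Delta> * V\<^sup>T)) i - sing_val (S * A) i\<bar>
        \<le> ((1 + \<epsilon>)\<^sup>2 / (1 - \<epsilon>) * \<kappa>) * \<eta> * sing_val A r"
proof -
  define B where "B = \<Phi> * A"
  have B: "B \<in> carrier_mat s n" using A \<Phi> by (simp add: B_def)
  have Bv: "B *\<^sub>v x = \<Phi> *\<^sub>v (A *\<^sub>v x)" if "x \<in> carrier_vec n" for x
    unfolding B_def using A \<Phi> that by (intro assoc_mult_mat_vec) auto
  have embB: "\<forall>x \<in> carrier_vec n.
      (1 - \<epsilon>) * vnorm (A *\<^sub>v x) \<le> vnorm (B *\<^sub>v x) \<and> vnorm (B *\<^sub>v x) \<le> (1 + \<epsilon>) * vnorm (A *\<^sub>v x)"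
    using emb Bv by simp
  note es = embedding_sing_vals[OF A B \<epsilon> embB]
  have rB: "mrank B = r" using es(3) r by simp
  then show "mrank (\<Phi> * A) = r" by (simp add: B_def)
  have Bpos: "0 < sing_val B r" using sing_val_pos_iff_le_mrank[OF r(2)] rB by simp
  then show "0 < sing_val (\<Phi> * A) r" by (simp add: B_def)
  have Apos: "0 < sing_val A r" using sing_val_pos_iff_le_mrank[OF r(2)] r(1) by simp
  have A1: "sing_val A 1 \<le> \<kappa> * sing_val A r"
    using cond Apos unfolding cond_number_def r(1) by (simp add: field_simps)
  have "1 * sing_val A r \<le> \<kappa> * sing_val A r" using A1 sing_val_antimono[of 1 r A] r(2) by simp
  then have \<kappa>: "1 \<le> \<kappa>" using Apos by simp
  define g where "g = sv_geometric_mean B"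
  have g_lo: "(1 - \<epsilon>) * sing_val A r \<le> g"
    using es(1)[OF r(2)] sv_geometric_mean_bounds(1)[OF rB r(2)] by (simp add: g_def)
  have g_up: "g \<le> (1 + \<epsilon>) * (\<kappa> * sing_val A r)"
  proof -
    have "g \<le> (1 + \<epsilon>) * sing_val A 1"
      using es(2)[of 1] sv_geometric_mean_bounds(2)[OF rB r(2)] by (simp add: g_def)
    also have "\<dots> \<le> (1 + \<epsilon>) * (\<kappa> * sing_val A r)" using A1 \<epsilon> by (intro mult_left_mono) auto
    finally show ?thesis .
  qed
  have g0: "0 < g" using g_lo mult_pos_pos[of "1 - \<epsilon>" "sing_val A r"] Apos \<epsilon> by linarith
  have ratio: "g / sing_val B r \<le> (1 + \<epsilon>) / (1 - \<epsilon>) * \<kappa>"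
  proof -
    have "g / sing_val B r \<le> (1 + \<epsilon>) * (\<kappa> * sing_val A r) / ((1 - \<epsilon>) * sing_val A r)"
      using g_up g0 es(1)[OF r(2)] Apos \<epsilon> by (intro frac_le) auto
    also have "\<dots> = (1 + \<epsilon>) / (1 - \<epsilon>) * \<kappa>" using Apos by simp
    finally show ?thesis .
  qed
  have rn: "r \<le> n" using mrank_le_dim_col[of A] A r by simp

  fix U\<^sub>B \<Sigma>\<^sub>B V\<^sub>B S
  assume "thin_svd (\<Phi> * A) U\<^sub>B \<Sigma>\<^sub>B V\<^sub>B" and S_eq: "S = balancing_matrix (\<Phi> * A) U\<^sub>B * \<Phi>"
  then have svdB: "thin_svd B U\<^sub>B \<Sigma>\<^sub>B V\<^sub>B" by (simp add: B_def)
  define W where "W = balancing_matrix B U\<^sub>B"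
  have W: "W \<in> carrier_mat s s"
    using balancing_matrix_carrier[of U\<^sub>B B] thin_svdD(1)[OF svdB B rB] B rB by (simp add: W_def)
  have S: "S \<in> carrier_mat s m" using W \<Phi> unfolding S_eq by (simp add: W_def B_def)
  have SA: "S * A = W * B"
    unfolding S_eq W_def B_def using W \<Phi> A by (intro assoc_mult_mat[of _ s s _ m _ n]) (auto simp: W_def B_def)
  note sv = balanced_sing_vals[OF B rB r(2) svdB, folded W_def SA g_def]
  show "cond_number (S * A) = 1"
    using sv(1)[of 1] sv(1)[of r] sv(2) r(2) g0 by (simp add: cond_number_def)
  show "(1 - \<epsilon>) / \<kappa> * sing_val A i \<le> sing_val (S * A) i \<and>
            sing_val (S * A) i \<le> (1 + \<epsilon>) * \<kappa> * sing_val A i" if "i \<in> {1..r}" for i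
  proof -
    have i: "1 \<le> i" "i \<le> r" using that by auto
    have "sing_val A i \<le> \<kappa> * sing_val A r"
      using A1 sing_val_antimono[of 1 i A] i by simp
    then have "(1 - \<epsilon>) / \<kappa> * sing_val A i \<le> (1 - \<epsilon>) / \<kappa> * (\<kappa> * sing_val A r)"
      using \<epsilon> \<kappa> by (intro mult_left_mono) auto
    also have "\<dots> = (1 - \<epsilon>) * sing_val A r" using \<kappa> by simp
    finally have "(1 - \<epsilon>) / \<kappa> * sing_val A i \<le> g" using g_lo by simp
    moreover have "(1 + \<epsilon>) * \<kappa> * sing_val A r \<le> (1 + \<epsilon>) * \<kappa> * sing_val A i"
      using sing_val_antimono[OF i, of A] \<epsilon> \<kappa> by (intro mult_left_mono) auto
    ultimately show ?thesis using sv(1)[OF i] g_up by (simp add: mult.assoc)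
  qed
  fix U \<Sigma> V \<Delta> \<eta> i
  assume svdA: "thin_svd A U \<Sigma> V" and \<Delta>: "\<Delta> \<in> carrier_mat r r"
    and \<Delta>\<eta>: "spectral_norm \<Delta> \<le> \<eta> * sing_val A r" and "i \<in> {1..r}"
  then have i: "1 \<le> i" "i \<le> n" using rn by auto
  note sA = thin_svdD[OF svdA A r(1)]
  let ?E = "U * \<Delta> * V\<^sup>T"
  have E: "?E \<in> carrier_mat m n" using sA \<Delta> by auto
  have SE: "S * ?E \<in> carrier_mat s n" using S E by simp
  have bound: "vnorm ((S * ?E) *\<^sub>v x) \<le> ((1 + \<epsilon>)\<^sup>2 / (1 - \<epsilon>) * \<kappa>) * \<eta> * sing_val A r * vnorm x"
    if x: "x \<in> carrier_vec n" for x
  proof -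
    have Vx: "V\<^sup>T *\<^sub>v x \<in> carrier_vec r" using sA(3) x by auto
    define u where "u = \<Delta> *\<^sub>v (V\<^sup>T *\<^sub>v x)"
    have u: "u \<in> carrier_vec r" using \<Delta> Vx by (auto simp: u_def)
    have "?E *\<^sub>v x = (U * \<Delta>) *\<^sub>v (V\<^sup>T *\<^sub>v x)"
      using sA \<Delta> x by (intro assoc_mult_mat_vec[of _ m r _ n]) auto
    also have "\<dots> = U *\<^sub>v u"
      unfolding u_def using sA \<Delta> Vx by (intro assoc_mult_mat_vec[of _ m r _ r]) auto
    finally have Ex: "?E *\<^sub>v x = U *\<^sub>v u" .
    obtain y where y: "y \<in> carrier_vec n" and Ay: "A *\<^sub>v y = U *\<^sub>v u"
      using structured_perturbation_in_range[OF A r(1) svdA u] by blast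
    have "(S * ?E) *\<^sub>v x = S *\<^sub>v (A *\<^sub>v y)"
      using S E x Ex Ay by (subst assoc_mult_mat_vec[of _ s m _ n]) auto
    also have "\<dots> = W *\<^sub>v (B *\<^sub>v y)"
      unfolding Bv[OF y] unfolding S_eq B_def[symmetric] W_def[symmetric]
      using W \<Phi> A y by (intro assoc_mult_mat_vec[of _ s s _ m]) auto
    finally have "vnorm ((S * ?E) *\<^sub>v x) = vnorm (W *\<^sub>v (B *\<^sub>v y))" by simp
    also have "\<dots> \<le> g / sing_val B r * vnorm (B *\<^sub>v y)"
      unfolding W_def g_def by (rule balanced_vnorm(2)[OF B rB r(2) svdB y])
    also have "\<dots> \<le> ((1 + \<epsilon>) / (1 - \<epsilon>) * \<kappa>) * ((1 + \<epsilon>) * vnorm (A *\<^sub>v y))"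
      using bspec[OF embB y] ratio \<epsilon> \<kappa> vnorm_nonneg by (intro mult_mono) auto
    also have "vnorm (A *\<^sub>v y) = vnorm u"
      unfolding Ay by (rule vnorm_orthonormal_cols[OF sA(1,2) u])
    also have "((1 + \<epsilon>) / (1 - \<epsilon>) * \<kappa>) * ((1 + \<epsilon>) * vnorm u) = ((1 + \<epsilon>)\<^sup>2 / (1 - \<epsilon>) * \<kappa>) * vnorm u"
      by (simp add: power2_eq_square)
    also have "\<dots> \<le> ((1 + \<epsilon>)\<^sup>2 / (1 - \<epsilon>) * \<kappa>) * (\<eta> * sing_val A r * vnorm x)"
    proof (rule mult_left_mono)
      have "vnorm u \<le> spectral_norm \<Delta> * vnorm (V\<^sup>T *\<^sub>v x)"
        unfolding u_def by (rule vnorm_mult_le_spectral_norm[OF \<Delta> Vx])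
      also have "\<dots> \<le> (\<eta> * sing_val A r) * vnorm (V\<^sup>T *\<^sub>v x)"
        using \<Delta>\<eta> vnorm_nonneg by (intro mult_right_mono) auto
      also have "\<dots> \<le> (\<eta> * sing_val A r) * vnorm x"
      proof (rule mult_left_mono)
        (* The spectral norm dominates the length of the image of a unit vector,
           which exists because 1 \<le> r. *)
        show "0 \<le> \<eta> * sing_val A r"
        proof -
          have "0 \<le> vnorm (\<Delta> *\<^sub>v unit_vec r 0)" by (rule vnorm_nonneg)
          also have "\<dots> \<le> spectral_norm \<Delta> * vnorm (unit_vec r 0)"
            by (rule vnorm_mult_le_spectral_norm[OF \<Delta>]) simp
          also have "vnorm (unit_vec r 0) = 1" using r(2) by (simp add: vnorm_def)
          finally show ?thesis using \<Delta>\<eta> by simp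
        qed
      qed (rule vnorm_orthonormal_cols_transpose_le[OF sA(3,4) x])
      finally show "vnorm u \<le> \<eta> * sing_val A r * vnorm x" .
    qed (use \<epsilon> \<kappa> in auto)
    finally show ?thesis by (simp add: mult.assoc)
  qed
  have "S * (A + ?E) = S * A + S * ?E" using S A E by (intro mult_add_distrib_mat) auto
  moreover have "S * A \<in> carrier_mat s n" using S A by simp
  ultimately show "\<bar>sing_val (S * (A + ?E)) i - sing_val (S * A) i\<bar>
        \<le> ((1 + \<epsilon>)\<^sup>2 / (1 - \<epsilon>) * \<kappa>) * \<eta> * sing_val A r"
    using sing_val_perturbation[OF _ SE i] bound by metis
qed

lemma sketching_distribution_carrier:
  assumes D: "sketching_distribution s m D" and E: "E \<in> sets D" and \<omega>: "\<omega> \<in> E"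
  shows "\<omega> \<in> carrier_mat s m"
proof -
  have "space D = space (borel_mat s m)"
    using D sets_eq_imp_space_eq unfolding sketching_distribution_def by blast
  also have "\<dots> = carrier_mat s m" unfolding borel_mat_def by (intro space_measure_of) auto
  finally show ?thesis using sets.sets_into_space[OF E] \<omega> by auto
qed
theorem theorem1:
  shows "\<exists>C > 0. \<forall>(m::nat) (n::nat) (s::nat) (r::nat) (p::nat) (\<kappa>\<^sub>0::real) (\<epsilon>::real) (\<delta>::real)
      (A::real mat) (D::real mat measure).
    A \<in> carrier_mat m n \<longrightarrow> mrank A = r \<longrightarrow> r \<ge> 1 \<longrightarrow>
    \<kappa>\<^sub>0 \<ge> 1 \<longrightarrow> cond_number A \<le> \<kappa>\<^sub>0 \<longrightarrow>
    0 < \<epsilon> \<longrightarrow> \<epsilon> < 1 / 4 \<longrightarrow> 0 < \<delta> \<longrightarrow> \<delta> < 1 / 10 \<longrightarrow>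
    sketching_distribution s m D \<longrightarrow> column_sparse p D \<longrightarrow>
    oblivious_subspace_embedding \<epsilon> \<delta> r m D \<longrightarrow>
    real s \<ge> C * (1 / \<epsilon>\<^sup>2) * real r * ln (real r / \<delta>) \<longrightarrow>
    holds_with_prob D (1 - \<delta>) (\<lambda>\<Phi>.
      mrank (\<Phi> * A) = r \<and> sing_val (\<Phi> * A) r > 0 \<and>
      (\<forall>U\<^sub>B \<Sigma>\<^sub>B V\<^sub>B S. thin_svd (\<Phi> * A) U\<^sub>B \<Sigma>\<^sub>B V\<^sub>B \<longrightarrow> S = balancing_matrix (\<Phi> * A) U\<^sub>B * \<Phi> \<longrightarrow>
        (\<forall>i \<in> {1..r}.
            (1 - \<epsilon>) / \<kappa>\<^sub>0 * sing_val A i \<le> sing_val (S * A) i \<and>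
            sing_val (S * A) i \<le> (1 + \<epsilon>) * \<kappa>\<^sub>0 * sing_val A i) \<and>
        cond_number (S * A) = 1 \<and>
        (\<forall>U \<Sigma> V \<Delta> \<eta>. thin_svd A U \<Sigma> V \<longrightarrow> \<Delta> \<in> carrier_mat r r \<longrightarrow> 0 < \<eta> \<longrightarrow> \<eta> < 1 \<longrightarrow>
            spectral_norm \<Delta> \<le> \<eta> * sing_val A r \<longrightarrow>
            (\<forall>i \<in> {1..r}.
              \<bar>sing_val (S * (A + U * \<Delta> * V\<^sup>T)) i - sing_val (S * A) i\<bar>
                \<le> ((1 + \<epsilon>)\<^sup>2 / (1 - \<epsilon>) * \<kappa>\<^sub>0) * \<eta> * sing_val A r))))"
proof (intro exI[of _ 1] conjI allI impI)
  fix m n s r p :: nat and \<kappa>\<^sub>0 \<epsilon> \<delta> :: real and A :: "real mat" and D :: "real mat measure"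
  assume A: "A \<in> carrier_mat m n" and r: "mrank A = r" "r \<ge> 1"
    and cond: "cond_number A \<le> \<kappa>\<^sub>0" and \<epsilon>: "0 < \<epsilon>" "\<epsilon> < 1 / 4"
    and D: "sketching_distribution s m D" and ose: "oblivious_subspace_embedding \<epsilon> \<delta> r m D"
  have "holds_with_prob D (1 - \<delta>) (\<lambda>\<Phi>. \<forall>x \<in> carrier_vec n.
          (1 - \<epsilon>) * vnorm (A *\<^sub>v x) \<le> vnorm (\<Phi> *\<^sub>v (A *\<^sub>v x)) \<and>
          vnorm (\<Phi> *\<^sub>v (A *\<^sub>v x)) \<le> (1 + \<epsilon>) * vnorm (A *\<^sub>v x))"
    using ose A r(1) unfolding oblivious_subspace_embedding_def by simp
  then obtain E where E: "E \<in> sets D" "measure D E \<ge> 1 - \<delta>"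
    and emb: "\<And>\<Phi>. \<Phi> \<in> E \<Longrightarrow> \<forall>x \<in> carrier_vec n.
          (1 - \<epsilon>) * vnorm (A *\<^sub>v x) \<le> vnorm (\<Phi> *\<^sub>v (A *\<^sub>v x)) \<and>
          vnorm (\<Phi> *\<^sub>v (A *\<^sub>v x)) \<le> (1 + \<epsilon>) * vnorm (A *\<^sub>v x)"
    unfolding holds_with_prob_def by blast
  have \<epsilon>1: "\<epsilon> < 1" using \<epsilon> by simp
  show "holds_with_prob D (1 - \<delta>) (\<lambda>\<Phi>.
      mrank (\<Phi> * A) = r \<and> sing_val (\<Phi> * A) r > 0 \<and>
      (\<forall>U\<^sub>B \<Sigma>\<^sub>B V\<^sub>B S. thin_svd (\<Phi> * A) U\<^sub>B \<Sigma>\<^sub>B V\<^sub>B \<longrightarrow> S = balancing_matrix (\<Phi> * A) U\<^sub>B * \<Phi> \<longrightarrow>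
        (\<forall>i \<in> {1..r}.
            (1 - \<epsilon>) / \<kappa>\<^sub>0 * sing_val A i \<le> sing_val (S * A) i \<and>
            sing_val (S * A) i \<le> (1 + \<epsilon>) * \<kappa>\<^sub>0 * sing_val A i) \<and>
        cond_number (S * A) = 1 \<and>
        (\<forall>U \<Sigma> V \<Delta> \<eta>. thin_svd A U \<Sigma> V \<longrightarrow> \<Delta> \<in> carrier_mat r r \<longrightarrow> 0 < \<eta> \<longrightarrow> \<eta> < 1 \<longrightarrow>
            spectral_norm \<Delta> \<le> \<eta> * sing_val A r \<longrightarrow>
            (\<forall>i \<in> {1..r}.
              \<bar>sing_val (S * (A + U * \<Delta> * V\<^sup>T)) i - sing_val (S * A) i\<bar>
                \<le> ((1 + \<epsilon>)\<^sup>2 / (1 - \<epsilon>) * \<kappa>\<^sub>0) * \<eta> * sing_val A r))))"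
    unfolding holds_with_prob_def
  proof (intro bexI[of _ E] conjI ballI allI impI E)
    fix \<Phi> assume \<Phi>E: "\<Phi> \<in> E"
    note main = balanced_sketch_of_embedding[OF A sketching_distribution_carrier[OF D E(1) \<Phi>E] r cond
        \<epsilon>(1) \<epsilon>1 emb[OF \<Phi>E]]
    show "mrank (\<Phi> * A) = r" by (rule main(1))
    show "sing_val (\<Phi> * A) r > 0" by (rule main(2))
    fix U\<^sub>B \<Sigma>\<^sub>B V\<^sub>B S
    assume S: "thin_svd (\<Phi> * A) U\<^sub>B \<Sigma>\<^sub>B V\<^sub>B" "S = balancing_matrix (\<Phi> * A) U\<^sub>B * \<Phi>"
    show "(1 - \<epsilon>) / \<kappa>\<^sub>0 * sing_val A i \<le> sing_val (S * A) i"
      "sing_val (S * A) i \<le> (1 + \<epsilon>) * \<kappa>\<^sub>0 * sing_val A i" if "i \<in> {1..r}" for i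
      using main(3)[OF S that] by auto
    show "cond_number (S * A) = 1" by (rule main(4)[OF S])
    show "\<bar>sing_val (S * (A + U * \<Delta> * V\<^sup>T)) i - sing_val (S * A) i\<bar>
        \<le> ((1 + \<epsilon>)\<^sup>2 / (1 - \<epsilon>) * \<kappa>\<^sub>0) * \<eta> * sing_val A r"
      if "thin_svd A U \<Sigma> V" "\<Delta> \<in> carrier_mat r r" "spectral_norm \<Delta> \<le> \<eta> * sing_val A r" "i \<in> {1..r}"
      for U \<Sigma> V \<Delta> \<eta> i
      using main(5)[OF S that] .
  qed
qed simp

end
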